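(* A radial eigencubic $f$ admits a normal form with $n_2=0$ if and only if $f$ is congruent either to a Cartan polynomial $\theta_\ell$ with $\ell\in\{1,2,4,8\}$ or to $\theta_0:=x_2^3-3x_2x_1^2$ (on $\mathbb{R}^2$). Furthermore, in that case $n_1=\ell+1$ (where $\ell=0$ for $\theta_0$).
   Context: For a polynomial $f$ on $\mathbb{R}^n$ put $L(f)=|\nabla f|^2\Delta f-\sum_{i,j=1}^n f_{x_i}f_{x_j}f_{x_ix_j}$. A radial eigencubic in $\mathbb{R}^n$ is a homogeneous polynomial $f\not\equiv 0$ of degree 3 such that $L(f)=\lambda |x|^2 f$ for some constant $\lambda\in\mathbb{R}$, where it is assumed that $\lambda\neq 0$. Two cubic forms $f_1,f_2$ on $\mathbb{R}^n$ are congruent if $f_1(x)=cf_2(Ux)$ for some $U\in O(n)$ and some real $c\ne0$. A normal form of $f$ is an orthogonal decomposition $\mathbb{R}^n=\mathrm{span}(e_n)\oplus V_1\oplus V_2\oplus V_3$ ($e_n$ a unit vector, the $V_i$ possibly zero) such that, writing $x=x_ne_n+\xi+\eta+\zeta$ with $\xi\in V_1,\eta\in V_2,\zeta\in V_3$, after multiplication of $f$ by a nonzero constant, $$f=x_n^3-\tfrac32x_n(2|\xi|^2+|\eta|^2-|\zeta|^2)+\psi_{111}+\psi_{102}+\psi_{012}+\psi_{030},$$ where $\psi_{ijk}$ is homogeneous of degree $i$ in $\xi$, $j$ in $\eta$ and $k$ in $\zeta$; $n_i=\dim V_i$. For $\ell\in\{1,2,4,8\}$ let $\mathbb{F}_\ell$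 be $\mathbb{R},\mathbb{C},\mathbb{H},\mathbb{O}$ respectively. The Cartan polynomial $\theta_\ell$ is the cubic form on $\mathbb{R}^{3\ell+2}=\mathbb{R}^2\oplus\mathbb{F}_\ell^3\ni(x_1,x_2,z_1,z_2,z_3)$ given by $$\theta_\ell=x_1^3+\tfrac{3x_1}{2}\big(|z_1|^2+|z_2|^2-2|z_3|^2-2x_2^2\big)+\tfrac{3\sqrt3}{2}x_2\big(|z_1|^2-|z_2|^2\big)+3\sqrt3\,\mathrm{Re}(z_1z_2z_3),$$ where $\mathrm{Re}\,z=\frac12(z+\bar z)$ (the real part of a triple product is independent of bracketing). *)

theory Defs
  imports "HOL-Analysis.Analysis"
begin

section \<open>Radial eigencubics\<close>

text \<open>Polynomials on a Euclidean space are represented by the functions they induce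
  (the ground field is infinite, so nothing is lost).\<close>

definition cubic_form :: "('a::euclidean_space \<Rightarrow> real) \<Rightarrow> bool" where
  "cubic_form f \<longleftrightarrow> real_polynomial_function f \<and> (\<forall>t x. f (t *\<^sub>R x) = t ^ 3 * f x)"

definition partial :: "'n::finite \<Rightarrow> (real ^ 'n \<Rightarrow> real) \<Rightarrow> real ^ 'n \<Rightarrow> real" where
  "partial i f x = deriv (\<lambda>t. f (x + t *\<^sub>R axis i 1)) 0"

definition grad :: "(real ^ 'n \<Rightarrow> real) \<Rightarrow> real ^ 'n \<Rightarrow> real ^ 'n::finite" where
  "grad f x = (\<chi> i. partial i f x)"

definition laplacian :: "(real ^ 'n::finite \<Rightarrow> real) \<Rightarrow> real ^ 'n \<Rightarrow> real" where
  "laplacian f x = (\<Sum>i\<in>UNIV. partial i (partial i f) x)"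

definition L_op :: "(real ^ 'n::finite \<Rightarrow> real) \<Rightarrow> real ^ 'n \<Rightarrow> real" where
  "L_op f x = (norm (grad f x))\<^sup>2 * laplacian f x
     - (\<Sum>i\<in>UNIV. \<Sum>j\<in>UNIV. partial i f x * partial j f x * partial j (partial i f) x)"

definition radial_eigencubic :: "(real ^ 'n::finite \<Rightarrow> real) \<Rightarrow> bool" where
  "radial_eigencubic f \<longleftrightarrow> cubic_form f \<and> (\<exists>x. f x \<noteq> 0) \<and>
     (\<exists>lam. lam \<noteq> 0 \<and> (\<forall>x. L_op f x = lam * (norm x)\<^sup>2 * f x))"

text \<open>The forms may live on two different models of the same Euclidean space
  (for instance \<open>real ^ 'n\<close> and a product space), so \<open>U\<close> ranges over the linear
  isometries of the first model onto the second; this forces the dimensions to agree, and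
  on a single space it is the orthogonal group.\<close>

definition congruent_forms ::
  "('a::euclidean_space \<Rightarrow> real) \<Rightarrow> ('b::euclidean_space \<Rightarrow> real) \<Rightarrow> bool" where
  "congruent_forms f g \<longleftrightarrow>
     (\<exists>(U :: 'a \<Rightarrow> 'b) c. linear U \<and> (\<forall>v w. U v \<bullet> U w = v \<bullet> w) \<and> surj U \<and> c \<noteq> 0 \<and>
        (\<forall>x. f x = c * g (U x)))"

section \<open>Normal forms\<close>

text \<open>\<open>\<psi>\<close> is a polynomial, homogeneous of degree \<open>i\<close> in \<open>\<xi> \<in> V1\<close>, \<open>j\<close> in \<open>\<eta> \<in> V2\<close> and
  \<open>k\<close> in \<open>\<zeta> \<in> V3\<close>. Since \<open>0 ^ 0 = 1\<close>, degree \<open>0\<close> in a variable means independence of it.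
  Only the values of \<open>\<psi>\<close> on \<open>V1 \<times> V2 \<times> V3\<close> matter.\<close>

definition multihomogeneous ::
  "nat \<Rightarrow> nat \<Rightarrow> nat \<Rightarrow> 'a::euclidean_space set \<Rightarrow> 'a set \<Rightarrow> 'a set \<Rightarrow>
     ('a \<times> 'a \<times> 'a \<Rightarrow> real) \<Rightarrow> bool" where
  "multihomogeneous i j k V1 V2 V3 \<psi> \<longleftrightarrow> real_polynomial_function \<psi> \<and>
     (\<forall>\<xi>\<in>V1. \<forall>\<eta>\<in>V2. \<forall>\<zeta>\<in>V3. \<forall>r s t.
        \<psi> (r *\<^sub>R \<xi>, s *\<^sub>R \<eta>, t *\<^sub>R \<zeta>) = r ^ i * s ^ j * t ^ k * \<psi> (\<xi>, \<eta>, \<zeta>))"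

definition orthogonal_decomposition ::
  "'a::euclidean_space \<Rightarrow> 'a set \<Rightarrow> 'a set \<Rightarrow> 'a set \<Rightarrow> bool" where
  "orthogonal_decomposition e V1 V2 V3 \<longleftrightarrow>
     norm e = 1 \<and> subspace V1 \<and> subspace V2 \<and> subspace V3 \<and>
     (\<forall>\<xi>\<in>V1. \<forall>\<eta>\<in>V2. \<forall>\<zeta>\<in>V3.
        orthogonal e \<xi> \<and> orthogonal e \<eta> \<and> orthogonal e \<zeta> \<and>
        orthogonal \<xi> \<eta> \<and> orthogonal \<xi> \<zeta> \<and> orthogonal \<eta> \<zeta>) \<and>
     (\<forall>x. \<exists>t. \<exists>\<xi>\<in>V1. \<exists>\<eta>\<in>V2. \<exists>\<zeta>\<in>V3. x = t *\<^sub>R e + \<xi> + \<eta> + \<zeta>)"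

definition normal_form ::
  "('a::euclidean_space \<Rightarrow> real) \<Rightarrow> 'a \<Rightarrow> 'a set \<Rightarrow> 'a set \<Rightarrow> 'a set \<Rightarrow> bool" where
  "normal_form f e V1 V2 V3 \<longleftrightarrow> orthogonal_decomposition e V1 V2 V3 \<and>
     (\<exists>c \<psi>111 \<psi>102 \<psi>012 \<psi>030. c \<noteq> 0 \<and>
        multihomogeneous 1 1 1 V1 V2 V3 \<psi>111 \<and>
        multihomogeneous 1 0 2 V1 V2 V3 \<psi>102 \<and>
        multihomogeneous 0 1 2 V1 V2 V3 \<psi>012 \<and>
        multihomogeneous 0 3 0 V1 V2 V3 \<psi>030 \<and>
        (\<forall>t. \<forall>\<xi>\<in>V1. \<forall>\<eta>\<in>V2. \<forall>\<zeta>\<in>V3.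
           c * f (t *\<^sub>R e + \<xi> + \<eta> + \<zeta>) =
             t ^ 3 - 3 / 2 * t * (2 * (norm \<xi>)\<^sup>2 + (norm \<eta>)\<^sup>2 - (norm \<zeta>)\<^sup>2)
             + \<psi>111 (\<xi>, \<eta>, \<zeta>) + \<psi>102 (\<xi>, \<eta>, \<zeta>) + \<psi>012 (\<xi>, \<eta>, \<zeta>) + \<psi>030 (\<xi>, \<eta>, \<zeta>)))"

section \<open>Quaternions and octonions\<close>

text \<open>Both algebras arise by Cayley--Dickson doubling from the complex numbers; \<open>m\<close> and
  \<open>k\<close> are the multiplication and the conjugation of the algebra being doubled. The norm of
  the product type is the usual norm \<open>\<bar>z\<bar>\<close> of the doubled algebra.\<close>

fun cd_mult :: "('a::ab_group_add \<Rightarrow> 'a \<Rightarrow> 'a) \<Rightarrow> ('a \<Rightarrow> 'a) \<Rightarrow> 'a \<times> 'a \<Rightarrow> 'a \<times> 'a \<Rightarrow> 'a \<times> 'a" where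
  "cd_mult m k (a, b) (c, d) = (m a c - m (k d) b, m d a + m b (k c))"

fun cd_cnj :: "('a::ab_group_add \<Rightarrow> 'a) \<Rightarrow> 'a \<times> 'a \<Rightarrow> 'a \<times> 'a" where
  "cd_cnj k (a, b) = (k a, - b)"

type_synonym quat = "complex \<times> complex"
type_synonym octo = "quat \<times> quat"

definition quat_mult :: "quat \<Rightarrow> quat \<Rightarrow> quat" where "quat_mult = cd_mult (*) cnj"
definition quat_cnj :: "quat \<Rightarrow> quat" where "quat_cnj = cd_cnj cnj"
definition quat_Re :: "quat \<Rightarrow> real" where "quat_Re z = Re (fst z)"

definition octo_mult :: "octo \<Rightarrow> octo \<Rightarrow> octo" where "octo_mult = cd_mult quat_mult quat_cnj"
definition octo_cnj :: "octo \<Rightarrow> octo" where "octo_cnj = cd_cnj quat_cnj"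
definition octo_Re :: "octo \<Rightarrow> real" where "octo_Re z = quat_Re (fst z)"

lemma quat_half_sum_cnj: "(1 / 2) *\<^sub>R (z + quat_cnj z) = (of_real (quat_Re z), 0)"
  by (cases z) (simp add: quat_cnj_def quat_Re_def complex_eq_iff)

lemma octo_half_sum_cnj: "(1 / 2) *\<^sub>R (z + octo_cnj z) = ((of_real (octo_Re z), 0), 0)"
  by (cases z) (simp add: octo_cnj_def octo_Re_def quat_half_sum_cnj zero_prod_def)

lemma quat_mult_cnj: "quat_mult z (quat_cnj z) = (of_real ((norm z)\<^sup>2), 0)"
  by (cases z)
    (simp add: quat_mult_def quat_cnj_def norm_Pair complex_eq_iff cmod_power2
      flip: power2_eq_square)

lemma norm_quat_mult: "norm (quat_mult x y) = norm x * norm y"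
proof -
  have "(norm (quat_mult x y))\<^sup>2 = (norm x * norm y)\<^sup>2"
    by (cases x; cases y)
      (simp add: quat_mult_def norm_Pair cmod_power2 power_mult_distrib,
       simp add: power2_eq_square algebra_simps)
  then show ?thesis
    by (simp add: power2_eq_iff_nonneg)
qed

lemma norm_octo_mult: "norm (octo_mult x y) = norm x * norm y"
proof -
  have "(norm (octo_mult x y))\<^sup>2 = (norm x * norm y)\<^sup>2"
    by (cases x; cases "fst x"; cases "snd x"; cases y; cases "fst y"; cases "snd y")
      (simp add: octo_mult_def quat_mult_def quat_cnj_def norm_Pair cmod_power2
        power_mult_distrib, simp add: power2_eq_square algebra_simps)
  then show ?thesis
    by (simp add: power2_eq_iff_nonneg)
qed

section \<open>Cartan polynomials\<close>

text \<open>\<open>m\<close> and \<open>re\<close> are the multiplication and the real part of the algebra \<open>'f\<close>.\<close>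

fun cartan_poly ::
  "('f::euclidean_space \<Rightarrow> 'f \<Rightarrow> 'f) \<Rightarrow> ('f \<Rightarrow> real) \<Rightarrow> real \<times> real \<times> 'f \<times> 'f \<times> 'f \<Rightarrow> real" where
  "cartan_poly m re (x1, x2, z1, z2, z3) =
     x1 ^ 3
     + 3 * x1 / 2 * ((norm z1)\<^sup>2 + (norm z2)\<^sup>2 - 2 * (norm z3)\<^sup>2 - 2 * x2\<^sup>2)
     + 3 * sqrt 3 / 2 * x2 * ((norm z1)\<^sup>2 - (norm z2)\<^sup>2)
     + 3 * sqrt 3 * re (m (m z1 z2) z3)"

definition theta1 :: "real \<times> real \<times> real \<times> real \<times> real \<Rightarrow> real" where
  "theta1 = cartan_poly (*) (\<lambda>z. z)"

definition theta2 :: "real \<times> real \<times> complex \<times> complex \<times> complex \<Rightarrow> real" where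
  "theta2 = cartan_poly (*) Re"

definition theta4 :: "real \<times> real \<times> quat \<times> quat \<times> quat \<Rightarrow> real" where
  "theta4 = cartan_poly quat_mult quat_Re"

definition theta8 :: "real \<times> real \<times> octo \<times> octo \<times> octo \<Rightarrow> real" where
  "theta8 = cartan_poly octo_mult octo_Re"

fun theta0 :: "real \<times> real \<Rightarrow> real" where
  "theta0 (x1, x2) = x2 ^ 3 - 3 * x2 * x1\<^sup>2"

end

theory Submission
  imports Defs
begin

text \<open>Write a cubic form as \<open>f x = M x x \<bullet> x\<close> with a commutative product \<open>M\<close> for which \<open>M x y \<bullet> z\<close>
  is symmetric. For a normal form with \<open>V2 = 0\<close>, comparing the odd powers of \<open>t\<close> in
  \<open>L f = \<lambda> \<bar>x\<bar>\<^sup>2 f\<close> at \<open>t e + \<xi> + \<zeta>\<close> gives \<open>dim V3 = 2 (dim V1 - 1)\<close>,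
  \<open>\<bar>M \<xi> \<zeta>\<bar>\<^sup>2 = 3/4 \<bar>\<xi>\<bar>\<^sup>2 \<bar>\<zeta>\<bar>\<^sup>2\<close> and \<open>\<bar>M \<zeta> \<zeta>\<bar> = \<bar>\<zeta>\<bar>\<^sup>2\<close>. Up to the factor \<open>2 / \<surd>3\<close>, \<open>M\<close> thus
  makes \<open>V1\<close> act on \<open>V3\<close> by a Clifford system. Fix a unit vector \<open>z0 \<in> V1\<close>; its orthogonal
  complement in \<open>V1\<close> and the two eigenspaces of \<open>z0\<close> on \<open>V3\<close> form a triality in which all products
  multiply norms, hence carry a composition algebra. By Hurwitz' theorem (Cayley--Dickson doubling
  inside the algebra, which stops at the octonions since the sedenions have zero divisors) it is
  \<open>\<real>\<close>, \<open>\<complex>\<close>, the quaternions or the octonions, and the trilinear form \<open>M \<xi> \<zeta> \<bullet> \<zeta>\<close> becomes \<open>Re (z1 z2 z3)\<close>.\<close>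

section \<open>Cubic forms and their algebras\<close>

text \<open>Setting \<eta> = 0 kills every \<psi> except \<psi>102, so the only unknown part of
  \<open>M\<close> is the action of \<open>V1\<close> on \<open>V3\<close>. The eigenvalue is not
  known in advance: the coefficients of \<open>t^5\<close> and \<open>t^3\<close> become useful
  together, when eliminating \<open>lam\<close> forces the trace of \<open>M e\<close> to vanish.
  This one fact yields both the dimension relation and the eigenvalue -54 on which the two norm
  identities rest. The identity for \<open>M \<xi> \<zeta>\<close> supplies the norm laws for the
  complement of \<open>z0\<close> acting on the two eigenspaces; the third law, for products of the
  two eigenspaces, is drawn from the identity for \<open>M \<zeta> \<zeta>\<close> at
  \<open>u + v\<close> and \<open>u - v\<close>. A triality has no unit: unit vectors chosen in two
  of its spaces create one, which is why the case where \<open>V1\<close> is a line stands apart and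
  gives \<open>theta0\<close>. Conversely, the coordinates of a Cartan polynomial already exhibit a
  normal form, which is transported along the isometry. The ambient dimension is
  \<open>3 * dim V1 - 1\<close>, and congruence preserves it, so it pins down
  \<open>dim V1\<close>.\<close>

definition symmetric_trilinear :: "('a::real_vector \<Rightarrow> 'a \<Rightarrow> 'a \<Rightarrow> real) \<Rightarrow> bool" where
  "symmetric_trilinear T \<longleftrightarrow> (\<forall>x y. linear (T x y)) \<and>
     (\<forall>x y z. T x y z = T y x z) \<and> (\<forall>x y z. T x y z = T x z y)"

lemma linear_real_iff:
  fixes l :: "'a::real_vector \<Rightarrow> real"
  shows "linear l \<longleftrightarrow> (\<forall>x y. l (x + y) = l x + l y) \<and> (\<forall>r x. l (r *\<^sub>R x) = r * l x)"
  by (simp add: linear_iff)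

text \<open>The terms of degree at most three of \<open>f\<close>, read off from the polynomials \<open>t \<mapsto> f (t x)\<close>; carrying
  the lower ones along makes the statement stable under products.\<close>

lemma real_polynomial_function_expansion:
  fixes f :: "'a::euclidean_space \<Rightarrow> real"
  assumes "real_polynomial_function f"
  shows "\<exists>c l B T. linear l \<and> bilinear B \<and> (\<forall>x y. B x y = B y x) \<and> symmetric_trilinear T \<and>
    (\<forall>x. \<exists>p. (\<forall>t. f (t *\<^sub>R x) = poly p t) \<and> coeff p 0 = c \<and> coeff p 1 = l x \<and>
       coeff p 2 = B x x \<and> coeff p 3 = T x x x)"
  using assms
proof induction
  case (linear f)
  then have "linear f" by (simp add: bounded_linear.linear)
  moreover have "f (t *\<^sub>R x) = poly [:0, f x:] t" for t x
    using \<open>linear f\<close> by (simp add: linear_scale)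
  ultimately show ?case
    by (intro exI[of _ 0] exI[of _ f] exI[of _ "\<lambda>x y. 0"] exI[of _ "\<lambda>x y z. 0"])
      (auto simp: symmetric_trilinear_def bilinear_def linear_real_iff eval_nat_numeral
        intro!: exI[of _ "[:0, f _:]"])
next
  case (const c)
  show ?case
    by (intro exI[of _ c] exI[of _ "\<lambda>x. 0"] exI[of _ "\<lambda>x y. 0"] exI[of _ "\<lambda>x y z. 0"])
      (auto simp: symmetric_trilinear_def bilinear_def linear_real_iff eval_nat_numeral
        intro!: exI[of _ "[:c:]"])
next
  case (add f g)
  from add.IH obtain c l B T where f: "linear l" "bilinear B" "\<And>x y. B x y = B y x"
    "symmetric_trilinear T" "\<And>x. \<exists>p. (\<forall>t. f (t *\<^sub>R x) = poly p t) \<and> coeff p 0 = c \<and>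
       coeff p 1 = l x \<and> coeff p 2 = B x x \<and> coeff p 3 = T x x x"
    by metis
  from add.IH obtain c' l' B' T' where g: "linear l'" "bilinear B'" "\<And>x y. B' x y = B' y x"
    "symmetric_trilinear T'" "\<And>x. \<exists>p. (\<forall>t. g (t *\<^sub>R x) = poly p t) \<and> coeff p 0 = c' \<and>
       coeff p 1 = l' x \<and> coeff p 2 = B' x x \<and> coeff p 3 = T' x x x"
    by metis
  show ?case
  proof (rule exI[of _ "c + c'"], rule exI[of _ "\<lambda>x. l x + l' x"],
      rule exI[of _ "\<lambda>x y. B x y + B' x y"],
      rule exI[of _ "\<lambda>x y z. T x y z + T' x y z"], intro conjI allI)
    show "linear (\<lambda>x. l x + l' x)" "bilinear (\<lambda>x y. B x y + B' x y)"
      "symmetric_trilinear (\<lambda>x y z. T x y z + T' x y z)"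
      using f(1,2,4) g(1,2,4)
      by (auto simp: symmetric_trilinear_def bilinear_def linear_real_iff algebra_simps)
    show "B x y + B' x y = B y x + B' y x" for x y
      using f(3) g(3) by metis
    fix x
    obtain p q where "\<forall>t. f (t *\<^sub>R x) = poly p t" "coeff p 0 = c"
       "coeff p 1 = l x" "coeff p 2 = B x x" "coeff p 3 = T x x x"
       "\<forall>t. g (t *\<^sub>R x) = poly q t" "coeff q 0 = c'"
       "coeff q 1 = l' x" "coeff q 2 = B' x x" "coeff q 3 = T' x x x"
      using f(5) g(5) by metis
    then show "\<exists>p. (\<forall>t. f (t *\<^sub>R x) + g (t *\<^sub>R x) = poly p t) \<and> coeff p 0 = c + c' \<and>
       coeff p 1 = l x + l' x \<and> coeff p 2 = B x x + B' x x \<and> coeff p 3 = T x x x + T' x x x"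
      by (intro exI[of _ "p + q"]) auto
  qed
next
  case (mult f g)
  from mult.IH obtain c l B T where f: "linear l" "bilinear B" "\<And>x y. B x y = B y x"
    "symmetric_trilinear T" "\<And>x. \<exists>p. (\<forall>t. f (t *\<^sub>R x) = poly p t) \<and> coeff p 0 = c \<and>
       coeff p 1 = l x \<and> coeff p 2 = B x x \<and> coeff p 3 = T x x x"
    by metis
  from mult.IH obtain c' l' B' T' where g: "linear l'" "bilinear B'" "\<And>x y. B' x y = B' y x"
    "symmetric_trilinear T'" "\<And>x. \<exists>p. (\<forall>t. g (t *\<^sub>R x) = poly p t) \<and> coeff p 0 = c' \<and>
       coeff p 1 = l' x \<and> coeff p 2 = B' x x \<and> coeff p 3 = T' x x x"
    by metis
  \<comment> \<open>The coefficients of \<open>t^2\<close> and \<open>t^3\<close> in a product;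
    mixed products of lower parts are averaged over the arguments to keep them symmetric.\<close>
  let ?B = "\<lambda>x y. c * B' x y + c' * B x y + (l x * l' y + l y * l' x) / 2"
  let ?T = "\<lambda>x y z. c * T' x y z + c' * T x y z
    + (l x * B' y z + l y * B' x z + l z * B' x y) / 3
    + (l' x * B y z + l' y * B x z + l' z * B x y) / 3"
  show ?case
  proof (rule exI[of _ "c * c'"], rule exI[of _ "\<lambda>x. c * l' x + c' * l x"],
      rule exI[of _ ?B], rule exI[of _ ?T], intro conjI allI)
    show "linear (\<lambda>x. c * l' x + c' * l x)" "bilinear ?B"
      using f(1,2) g(1,2)
      by (auto simp: bilinear_def linear_real_iff algebra_simps add_divide_distrib)
    show "?B x y = ?B y x" for x y
      using f(3)[of x y] g(3)[of x y] by (simp add: algebra_simps)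
    have "?T x y z = ?T y x z" "?T x y z = ?T x z y" for x y z
    proof -
      have "T x y z = T y x z" "T' x y z = T' y x z" "T x y z = T x z y" "T' x y z = T' x z y"
        using f(4) g(4) unfolding symmetric_trilinear_def by blast+
      then show "?T x y z = ?T y x z" "?T x y z = ?T x z y"
        using f(3)[of x y] g(3)[of x y] f(3)[of y z] g(3)[of y z] f(3)[of x z] g(3)[of x z]
        by (simp_all add: algebra_simps)
    qed
    moreover have "linear (?T x y)" for x y
    proof -
      have "linear (T x y)" "linear (T' x y)" using f(4) g(4) by (auto simp: symmetric_trilinear_def)
      moreover have "linear (B x)" "linear (B' x)" "linear (B y)" "linear (B' y)"
        using f(2) g(2) by (auto simp: bilinear_def)
      ultimately show ?thesis using f(1) g(1)
        by (auto simp: linear_real_iff algebra_simps add_divide_distrib)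
    qed
    ultimately show "symmetric_trilinear ?T"
      unfolding symmetric_trilinear_def by blast
    fix x
    obtain p q where "\<forall>t. f (t *\<^sub>R x) = poly p t" "coeff p 0 = c"
       "coeff p 1 = l x" "coeff p 2 = B x x" "coeff p 3 = T x x x"
       "\<forall>t. g (t *\<^sub>R x) = poly q t" "coeff q 0 = c'"
       "coeff q 1 = l' x" "coeff q 2 = B' x x" "coeff q 3 = T' x x x"
      using f(5) g(5) by metis
    then show "\<exists>p. (\<forall>t. f (t *\<^sub>R x) * g (t *\<^sub>R x) = poly p t) \<and> coeff p 0 = c * c' \<and>
       coeff p 1 = c * l' x + c' * l x \<and> coeff p 2 = ?B x x \<and> coeff p 3 = ?T x x x"
      by (intro exI[of _ "p * q"]) (simp add: coeff_mult eval_nat_numeral)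
  qed
qed

text \<open>The commutative algebra of a cubic form: its trilinear polarization is
  \<open>(x, y, z) \<mapsto> M x y \<bullet> z\<close>.\<close>

definition symmetric_algebra :: "('a::real_inner \<Rightarrow> 'a \<Rightarrow> 'a) \<Rightarrow> bool" where
  "symmetric_algebra M \<longleftrightarrow> bilinear M \<and> (\<forall>x y. M x y = M y x) \<and>
     (\<forall>x y z. M x y \<bullet> z = M x z \<bullet> y)"

text \<open>\<open>M x y\<close> is the vector that represents the linear form
  \<open>T x y\<close>.\<close>

lemma cubic_form_algebra:
  fixes f :: "'a::euclidean_space \<Rightarrow> real"
  assumes "cubic_form f"
  obtains M where "symmetric_algebra M" "\<forall>x. f x = M x x \<bullet> x"
proof -
  obtain c l B T where T: "symmetric_trilinear T"
    and p: "\<And>x. \<exists>p. (\<forall>t. f (t *\<^sub>R x) = poly p t) \<and> coeff p 0 = c \<and>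
       coeff p 1 = l x \<and> coeff p 2 = B x x \<and> coeff p 3 = T x x x"
    using assms real_polynomial_function_expansion[of f] unfolding cubic_form_def by metis
  have fT: "f x = T x x x" for x
  proof -
    obtain p where p: "\<forall>t. f (t *\<^sub>R x) = poly p t" "coeff p 3 = T x x x"
      using p by blast
    \<comment> \<open>Homogeneity turns \<open>p\<close> into a monomial, so its cubic coefficient
      \<open>T x x x\<close> is \<open>f x\<close> itself.\<close>
    have "poly p t = poly (monom (f x) 3) t" for t
      using assms p(1) unfolding cubic_form_def poly_monom by (metis mult.commute)
    then have "p = monom (f x) 3" by (simp add: poly_eq_poly_eq_iff[symmetric] fun_eq_iff)
    with p(2) show ?thesis by simp
  qed
  define M where "M x y = (\<Sum>b\<in>Basis. T x y b *\<^sub>R b)" for x y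
  have lin: "linear (T x y)" and sym: "T x y z = T y x z" "T x y z = T x z y" for x y z
    using T by (auto simp: symmetric_trilinear_def)
  have M: "M x y \<bullet> z = T x y z" for x y z
  proof -
    have "M x y \<bullet> z = (\<Sum>b\<in>Basis. T x y ((z \<bullet> b) *\<^sub>R b))"
      unfolding M_def
      by (simp add: inner_sum_left linear_scale[OF lin] inner_commute[of z] mult.commute[of "_ \<bullet> z"])
    also have "\<dots> = T x y (\<Sum>b\<in>Basis. (z \<bullet> b) *\<^sub>R b)"
      by (simp add: linear_sum[OF lin])
    finally show ?thesis by (simp add: euclidean_representation)
  qed
  have MM: "M x y = M y x" for x y
    by (rule vector_eq_rdot[THEN iffD1]) (metis M sym(1))
  have linM: "linear (M x)" for x
  proof (rule linearI)
    have T: "T x (a + b) z = T x a z + T x b z" "T x (r *\<^sub>R a) z = r * T x a z" for a b r z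
      using linear_add[OF lin] linear_scale[OF lin] sym(2) by (metis, metis real_scaleR_def)
    show "M x (a + b) = M x a + M x b" for a b
      by (rule vector_eq_rdot[THEN iffD1]) (simp add: M T inner_add_left)
    show "M x (r *\<^sub>R a) = r *\<^sub>R M x a" for r a
      by (rule vector_eq_rdot[THEN iffD1]) (simp add: M T)
  qed
  have "linear (\<lambda>x. M x y)" for y
    using linM[of y] by (simp only: MM[of _ y])
  then have "bilinear M" unfolding bilinear_def using linM by blast
  moreover have "M x y \<bullet> z = M x z \<bullet> y" for x y z
    by (simp only: M sym(2)[of x y z])
  ultimately have "symmetric_algebra M" unfolding symmetric_algebra_def using MM by blast
  moreover have "\<forall>x. f x = M x x \<bullet> x" by (simp add: M fT)
  ultimately show thesis ..
qed

lemma symmetric_algebra_simps: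
  assumes "symmetric_algebra M"
  shows "M (x + y) z = M x z + M y z" "M z (x + y) = M z x + M z y"
    "M (r *\<^sub>R x) z = r *\<^sub>R M x z" "M z (r *\<^sub>R x) = r *\<^sub>R M z x"
    "M (- x) z = - M x z" "M z (- x) = - M z x"
    "M (x - y) z = M x z - M y z" "M z (x - y) = M z x - M z y"
    "M 0 z = 0" "M z 0 = 0"
  using assms unfolding symmetric_algebra_def
  by (auto simp: bilinear_ladd bilinear_radd bilinear_lmul bilinear_rmul bilinear_lneg
      bilinear_rneg bilinear_lsub bilinear_rsub bilinear_lzero bilinear_rzero)

lemma symmetric_algebra_comm: "symmetric_algebra M \<Longrightarrow> M x y = M y x"
  and symmetric_algebra_inner: "symmetric_algebra M \<Longrightarrow> M x y \<bullet> z = M x z \<bullet> y"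
  unfolding symmetric_algebra_def by blast+

lemma symmetric_algebra_bounded_bilinear:
  fixes M :: "'a::euclidean_space \<Rightarrow> 'a \<Rightarrow> 'a"
  assumes "symmetric_algebra M"
  shows "bounded_bilinear M"
  using assms bilinear_conv_bounded_bilinear by (auto simp: symmetric_algebra_def)

section \<open>Gradient, Hessian and the operator L of a cubic form\<close>

context
  fixes M :: "real ^ 'n \<Rightarrow> real ^ 'n \<Rightarrow> real ^ 'n::finite" and f :: "real ^ 'n \<Rightarrow> real"
  assumes M: "symmetric_algebra M" and f: "\<And>x. f x = M x x \<bullet> x"
begin

lemma partial_cubic: "partial i f x = 3 * (M x x \<bullet> axis i 1)"
proof -
  note comm = symmetric_algebra_comm[OF M] and inv = symmetric_algebra_inner[OF M]
  let ?v = "axis i 1 :: real ^ 'n"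
  have "M ?v x \<bullet> x = M x x \<bullet> ?v" "M x ?v \<bullet> x = M x x \<bullet> ?v"
    using comm inv by metis+
  moreover have "M ?v ?v \<bullet> x = M x ?v \<bullet> ?v" "M ?v x \<bullet> ?v = M x ?v \<bullet> ?v"
    using comm inv by metis+
  ultimately have "f (x + t *\<^sub>R ?v) = f x + 3 * (M x x \<bullet> ?v) * t + 3 * (M x ?v \<bullet> ?v) * t ^ 2
      + (M ?v ?v \<bullet> ?v) * t ^ 3" for t
    unfolding f
    by (simp add: symmetric_algebra_simps[OF M] inner_add_left inner_add_right algebra_simps
        power2_eq_square power3_eq_cube)
  then have "(\<lambda>t. f (x + t *\<^sub>R ?v)) = (\<lambda>t. f x + 3 * (M x x \<bullet> ?v) * t + 3 * (M x ?v \<bullet> ?v) * t ^ 2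
      + (M ?v ?v \<bullet> ?v) * t ^ 3)" by blast
  moreover have "((\<lambda>t. f x + 3 * (M x x \<bullet> ?v) * t + 3 * (M x ?v \<bullet> ?v) * t ^ 2
      + (M ?v ?v \<bullet> ?v) * t ^ 3) has_field_derivative 3 * (M x x \<bullet> ?v)) (at 0)"
    by (auto intro!: derivative_eq_intros)
  ultimately show ?thesis
    unfolding partial_def by (metis DERIV_imp_deriv)
qed

lemma partial_partial_cubic: "partial j (partial i f) x = 6 * (M x (axis i 1) \<bullet> axis j 1)"
proof -
  note comm = symmetric_algebra_comm[OF M] and inv = symmetric_algebra_inner[OF M]
  let ?v = "axis i 1 :: real ^ 'n" and ?w = "axis j 1 :: real ^ 'n"
  have "M ?w x \<bullet> ?v = M x ?v \<bullet> ?w" "M x ?w \<bullet> ?v = M x ?v \<bullet> ?w"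
    using comm inv by metis+
  then have "(\<lambda>t. partial i f (x + t *\<^sub>R ?w)) =
      (\<lambda>t. 3 * (M x x \<bullet> ?v) + 6 * (M x ?v \<bullet> ?w) * t + 3 * (M ?w ?w \<bullet> ?v) * t ^ 2)"
    unfolding partial_cubic
    by (simp add: fun_eq_iff symmetric_algebra_simps[OF M] inner_add_left inner_add_right
        algebra_simps power2_eq_square)
  moreover have "((\<lambda>t. 3 * (M x x \<bullet> ?v) + 6 * (M x ?v \<bullet> ?w) * t + 3 * (M ?w ?w \<bullet> ?v) * t ^ 2)
      has_field_derivative 6 * (M x ?v \<bullet> ?w)) (at 0)"
    by (auto intro!: derivative_eq_intros)
  ultimately show ?thesis
    unfolding partial_def[of j] by (metis DERIV_imp_deriv)
qed

text \<open>The gradient is \<open>3 *\<^sub>R M x x\<close>, the Hessian is 6 times the operator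
  \<open>M x\<close>, and the Laplacian is the trace of the Hessian; both terms thus acquire the
  factor 3 * 3 * 6 = 54.\<close>

lemma L_op_cubic:
  "L_op f x = 54 * (M x x \<bullet> M x x) * (\<Sum>b\<in>Basis. M x b \<bullet> b) - 54 * (M x (M x x) \<bullet> M x x)"
proof -
  have G: "grad f x = 3 *\<^sub>R M x x"
    by (simp add: grad_def partial_cubic vec_eq_iff inner_axis)
  have bas: "(\<Sum>b\<in>Basis. g b) = (\<Sum>i\<in>UNIV. g (axis i 1))" for g :: "real ^ 'n \<Rightarrow> real"
  proof -
    have inj: "inj (\<lambda>i::'n. axis i (1::real))" by (simp add: inj_on_def axis_eq_axis)
    have "(Basis :: (real ^ 'n) set) = range (\<lambda>i. axis i 1)"
      by (auto simp: Basis_vec_def)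
    then show ?thesis using sum.reindex[OF inj, of g] by (simp only: o_def)
  qed
  have lap: "laplacian f x = 6 * (\<Sum>b\<in>Basis. M x b \<bullet> b)"
    unfolding laplacian_def partial_partial_cubic by (simp add: bas sum_distrib_left)
  have rep: "(\<Sum>i\<in>UNIV. partial i f x *\<^sub>R axis i 1) = grad f x"
    using basis_expansion[of "grad f x"] by (simp add: grad_def scalar_mult_eq_scaleR)
  interpret bounded_bilinear M by (rule symmetric_algebra_bounded_bilinear[OF M])
  have pp: "partial j (partial i f) x = 6 * (M x (axis j 1) \<bullet> axis i 1)" for i j
    using partial_partial_cubic[of j i x] symmetric_algebra_inner[OF M, of x "axis i 1" "axis j 1"] by linarith
  have "(\<Sum>i\<in>UNIV. \<Sum>j\<in>UNIV. partial i f x * partial j f x * partial j (partial i f) x)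
      = 6 * (M x (\<Sum>i\<in>UNIV. partial i f x *\<^sub>R axis i 1) \<bullet> (\<Sum>j\<in>UNIV. partial j f x *\<^sub>R axis j 1))"
    unfolding pp
    by (simp add: sum_right scaleR_right inner_sum_left inner_sum_right sum_distrib_left
        algebra_simps)
  then show ?thesis
    unfolding L_op_def lap rep G power2_norm_eq_inner
    by (simp add: symmetric_algebra_simps[OF M])
qed

end

section \<open>Composition algebras\<close>

text \<open>Working on a subspace lets \<open>mul\<close> be a total bilinear map while the laws
  hold on \<open>V\<close> only, and lets subalgebras be ranges of maps into one ambient space.
  Associativity is not among the laws, since the octonions have to qualify.\<close>

locale composition_algebra =
  fixes V :: "'a::euclidean_space set" and mul :: "'a \<Rightarrow> 'a \<Rightarrow> 'a" (infixl "\<star>" 75) and one :: 'a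
  assumes subspace_V: "subspace V" and bilinear_mul: "bilinear mul"
    and mul_closed: "x \<in> V \<Longrightarrow> y \<in> V \<Longrightarrow> x \<star> y \<in> V"
    and one_V: "one \<in> V" and norm_one: "norm one = 1"
    and one_left: "x \<in> V \<Longrightarrow> one \<star> x = x" and one_right: "x \<in> V \<Longrightarrow> x \<star> one = x"
    and norm_mul: "x \<in> V \<Longrightarrow> y \<in> V \<Longrightarrow> norm (x \<star> y) = norm x * norm y"
begin

lemmas mul_simps = bilinear_ladd[OF bilinear_mul] bilinear_radd[OF bilinear_mul]
  bilinear_lmul[OF bilinear_mul] bilinear_rmul[OF bilinear_mul]
  bilinear_lneg[OF bilinear_mul] bilinear_rneg[OF bilinear_mul]
  bilinear_lsub[OF bilinear_mul] bilinear_rsub[OF bilinear_mul]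

lemmas V_closed = subspace_add[OF subspace_V] subspace_diff[OF subspace_V]
  subspace_scale[OF subspace_V] subspace_neg[OF subspace_V] one_V mul_closed

text \<open>Conjugation, as the reflection that fixes \<open>one\<close> and negates its orthogonal
  complement.\<close>

definition cj :: "'a \<Rightarrow> 'a" where
  "cj x = (2 * (x \<bullet> one)) *\<^sub>R one - x"

lemma inner_mul_self: "x \<in> V \<Longrightarrow> y \<in> V \<Longrightarrow> (x \<star> y) \<bullet> (x \<star> y) = (x \<bullet> x) * (y \<bullet> y)"
  using norm_mul[of x y] by (simp flip: power2_norm_eq_inner add: power_mult_distrib)

lemma inner_mul_right:
  assumes "x \<in> V" "y \<in> V" "z \<in> V"
  shows "(x \<star> z) \<bullet> (y \<star> z) = (x \<bullet> y) * (z \<bullet> z)"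
  using inner_mul_self[of "x + y" z] inner_mul_self[of x z] inner_mul_self[of y z] assms
  by (simp add: V_closed mul_simps inner_add_left inner_add_right inner_commute algebra_simps)

text \<open>The norm law polarised in the left and then in the right factor; the adjoint rules and
  the doubling rules are drawn from it.\<close>

lemma exchange:
  assumes "x \<in> V" "y \<in> V" "u \<in> V" "v \<in> V"
  shows "(x \<star> y) \<bullet> (u \<star> v) + (x \<star> v) \<bullet> (u \<star> y) = 2 * (x \<bullet> u) * (y \<bullet> v)"
proof -
  have "(x \<star> (y + v)) \<bullet> (u \<star> (y + v)) = (x \<bullet> u) * ((y + v) \<bullet> (y + v))"
    "(x \<star> y) \<bullet> (u \<star> y) = (x \<bullet> u) * (y \<bullet> y)" "(x \<star> v) \<bullet> (u \<star> v) = (x \<bullet> u) * (v \<bullet> v)"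
    using assms by (simp_all add: inner_mul_right V_closed)
  then show ?thesis
    by (simp add: mul_simps inner_add_left inner_add_right inner_commute[of v y] algebra_simps)
qed

lemma inner_one [simp]: "one \<bullet> one = 1"
  using norm_one by (simp add: norm_eq_1)

lemma cj_closed [simp]: "x \<in> V \<Longrightarrow> cj x \<in> V"
  by (simp add: cj_def V_closed)

lemma cj_cj [simp]: "cj (cj x) = x"
  by (simp add: cj_def inner_diff_left algebra_simps)

lemma inner_cj: "cj x \<bullet> y = x \<bullet> cj y"
  by (simp add: cj_def inner_diff_left inner_diff_right inner_commute)

text \<open>With \<open>one\<close> for \<open>u\<close>, \<open>exchange\<close> leaves \<open>2 *
  (x \<bullet> one) * (y \<bullet> z) - (x \<star> z) \<bullet> y\<close>, which is the pairing of
  \<open>y\<close> with \<open>cj x \<star> z\<close>.\<close>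

lemma adjoint_left: "x \<in> V \<Longrightarrow> y \<in> V \<Longrightarrow> z \<in> V \<Longrightarrow> (x \<star> y) \<bullet> z = y \<bullet> (cj x \<star> z)"
  using exchange[of x y one z]
  by (simp add: one_V one_left cj_def mul_simps inner_diff_right inner_commute algebra_simps)

lemma adjoint_right: "x \<in> V \<Longrightarrow> y \<in> V \<Longrightarrow> z \<in> V \<Longrightarrow> (x \<star> y) \<bullet> z = x \<bullet> (z \<star> cj y)"
  using exchange[of x y z one]
  by (simp add: one_V one_right cj_def mul_simps inner_diff_right inner_commute algebra_simps)

lemma eq_if_inner_eq:
  assumes "x \<in> V" "y \<in> V" "\<And>z. z \<in> V \<Longrightarrow> x \<bullet> z = y \<bullet> z"
  shows "x = y"
proof -
  have "(x - y) \<bullet> (x - y) = 0"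
    using assms V_closed(2)[of x y] by (simp add: inner_diff_left)
  then show ?thesis by simp
qed

lemma cj_mul:
  assumes "x \<in> V" "y \<in> V"
  shows "cj (x \<star> y) = cj y \<star> cj x"
proof (rule eq_if_inner_eq)
  show "cj (x \<star> y) \<bullet> z = cj y \<star> cj x \<bullet> z" if z: "z \<in> V" for z
  proof -
    have "cj y \<star> cj x \<bullet> z = cj x \<bullet> y \<star> z" using assms z by (simp add: adjoint_left)
    also have "\<dots> = y \<bullet> cj x \<star> cj z"
      using adjoint_right[of y z "cj x"] assms z by (simp add: inner_commute)
    also have "\<dots> = x \<star> y \<bullet> cj z" using assms z by (simp add: adjoint_left)
    finally show ?thesis by (simp add: inner_cj)
  qed
qed (use assms in \<open>simp_all add: mul_closed\<close>)

text \<open>Conjugation is carried along because the doubled product is built from it. Asking only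
  that \<open>one\<close> lie in the range spares the model algebras a named unit.\<close>

definition embedding :: "('f::euclidean_space \<Rightarrow> 'f \<Rightarrow> 'f) \<Rightarrow> ('f \<Rightarrow> 'f) \<Rightarrow> ('f \<Rightarrow> 'a) \<Rightarrow> bool" where
  "embedding m k \<Phi> \<longleftrightarrow> linear \<Phi> \<and> range \<Phi> \<subseteq> V \<and> (\<forall>x. norm (\<Phi> x) = norm x) \<and> one \<in> range \<Phi> \<and>
     (\<forall>x y. \<Phi> (m x y) = \<Phi> x \<star> \<Phi> y) \<and> (\<forall>x. \<Phi> (k x) = cj (\<Phi> x))"

section \<open>Cayley-Dickson doubling of a subalgebra \<open>D\<close> by a unit vector
  \<open>j\<close> orthogonal to it\<close>

context
  fixes D j
  assumes D_V: "D \<subseteq> V" and D_mul': "\<forall>x\<in>D. \<forall>y\<in>D. x \<star> y \<in> D"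
    and D_cj': "\<forall>x\<in>D. cj x \<in> D" and one_D: "one \<in> D"
    and j: "j \<in> V" "norm j = 1" and j_D': "\<forall>x\<in>D. j \<bullet> x = 0"
begin

lemma inD: "x \<in> D \<Longrightarrow> x \<in> V" and D_mul: "x \<in> D \<Longrightarrow> y \<in> D \<Longrightarrow> x \<star> y \<in> D"
  and D_cj: "x \<in> D \<Longrightarrow> cj x \<in> D" and j_D: "x \<in> D \<Longrightarrow> j \<bullet> x = 0"
  using D_V D_mul' D_cj' j_D' by blast+

text \<open>The adjoint rule moves \<open>b\<close> over to \<open>cj b \<star> a\<close>, which
  lies in \<open>D\<close> and is therefore orthogonal to \<open>j\<close>.\<close>

lemma D_orthogonal_Dj: "a \<in> D \<Longrightarrow> b \<in> D \<Longrightarrow> a \<bullet> (b \<star> j) = 0"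
  using adjoint_left[of b j a] by (simp add: inD j j_D D_cj D_mul inner_commute)

lemma cj_Dj: "b \<in> D \<Longrightarrow> cj (b \<star> j) = - (b \<star> j)"
  using D_orthogonal_Dj[of one b] one_D by (simp add: cj_def inner_commute)

text \<open>Conjugation reverses products, and it negates both \<open>j\<close> and
  \<open>b \<star> j\<close> because both are orthogonal to \<open>one\<close>.\<close>

lemma j_mul: "b \<in> D \<Longrightarrow> b \<star> j = j \<star> cj b"
  using cj_mul[of b j] cj_Dj[of b] cj_Dj[of one] one_D
  by (simp add: inD j mul_simps one_left)

text \<open>With \<open>a + b \<star> j\<close> standing for the pair \<open>(a, b)\<close>, this
  rule and the next two are the terms of \<open>cd_mult\<close> that involve \<open>j\<close>. Each
  is tested against an arbitrary \<open>z\<close>; in the first two, \<open>exchange\<close>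
  contributes just a sign because \<open>j\<close> is orthogonal to \<open>D\<close>. The argument
  avoids associativity, so it still applies when \<open>D\<close> is a copy of the
  octonions.\<close>

lemma double1:
  assumes "a \<in> D" "b \<in> D"
  shows "a \<star> (b \<star> j) = (b \<star> a) \<star> j"
proof (rule eq_if_inner_eq)
  note V = assms[THEN inD] j(1)
  show "a \<star> (b \<star> j) \<bullet> z = (b \<star> a) \<star> j \<bullet> z" if z: "z \<in> V" for z
  proof -
    have "a \<star> (b \<star> j) \<bullet> z = (j \<star> cj b) \<bullet> (cj a \<star> z)"
      using adjoint_left[of a "b \<star> j" z] V z j_mul assms by (simp add: mul_closed)
    also have "\<dots> = - ((j \<star> z) \<bullet> (cj a \<star> cj b))"
      using exchange[of j "cj b" "cj a" z] V z assms by (simp add: j_D D_cj)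
    also have "cj a \<star> cj b = cj (b \<star> a)" using V by (simp add: cj_mul)
    also have "(j \<star> z) \<bullet> cj (b \<star> a) = - (z \<bullet> (j \<star> cj (b \<star> a)))"
      using adjoint_left[of j z "cj (b \<star> a)"] V z cj_Dj[of one] one_D
      by (simp add: mul_closed one_left mul_simps)
    also have "j \<star> cj (b \<star> a) = (b \<star> a) \<star> j"
      using j_mul D_mul assms by simp
    finally show ?thesis by (simp add: inner_commute)
  qed
qed (use assms inD j in \<open>simp_all add: mul_closed\<close>)

lemma double2:
  assumes "a \<in> D" "b \<in> D"
  shows "(a \<star> j) \<star> b = (a \<star> cj b) \<star> j"
proof (rule eq_if_inner_eq)
  note V = assms[THEN inD] j(1)
  show "(a \<star> j) \<star> b \<bullet> z = (a \<star> cj b) \<star> j \<bullet> z" if z: "z \<in> V" for z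
  proof -
    have "(a \<star> j) \<star> b \<bullet> z = (a \<star> j) \<bullet> (z \<star> cj b)"
      using adjoint_right[of "a \<star> j" b z] V z by (simp add: mul_closed)
    also have "\<dots> = - ((a \<star> cj b) \<bullet> (z \<star> j))"
      using exchange[of a j z "cj b"] V z assms by (simp add: j_D D_cj)
    also have "(a \<star> cj b) \<bullet> (z \<star> j) = - ((a \<star> cj b) \<star> j \<bullet> z)"
      using adjoint_right[of "a \<star> cj b" j z] V z cj_Dj[of one] one_D
      by (simp add: mul_closed one_left mul_simps)
    finally show ?thesis by simp
  qed
qed (use assms inD j in \<open>simp_all add: mul_closed\<close>)

lemma double3:
  assumes "a \<in> D" "b \<in> D"
  shows "(a \<star> j) \<star> (b \<star> j) = - (cj b \<star> a)"
proof (rule eq_if_inner_eq)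
  note V = assms[THEN inD] j(1)
  show "(a \<star> j) \<star> (b \<star> j) \<bullet> z = - (cj b \<star> a) \<bullet> z" if z: "z \<in> V" for z
  proof -
    have "(a \<star> j) \<star> (b \<star> j) \<bullet> z = - ((a \<star> j) \<bullet> (z \<star> (b \<star> j)))"
      using adjoint_right[of "a \<star> j" "b \<star> j" z] V z assms by (simp add: mul_closed cj_Dj mul_simps)
    \<comment> \<open>Unlike in the two rules above, the right side of \<open>exchange\<close>
      survives here; its value \<open>2 * (a \<bullet> z) * (b \<bullet> one)\<close> is what turns
      \<open>b\<close> into its conjugate.\<close>
    also have "(a \<star> j) \<bullet> (z \<star> (b \<star> j)) = 2 * (a \<bullet> z) * (j \<bullet> (b \<star> j)) - (a \<star> (b \<star> j)) \<bullet> (z \<star> j)"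
      using exchange[of a j z "b \<star> j"] V z by (simp add: mul_closed)
    also have "j \<bullet> (b \<star> j) = b \<bullet> one"
      using inner_mul_right[of one b j] V j(2) one_V
      by (simp add: one_left inner_commute norm_eq_1)
    also have "(a \<star> (b \<star> j)) \<bullet> (z \<star> j) = (b \<star> a) \<bullet> z"
      using inner_mul_right[of "b \<star> a" z j] V z j(2) assms
      by (simp add: double1 mul_closed norm_eq_1)
    also have "2 * (a \<bullet> z) * (b \<bullet> one) - (b \<star> a) \<bullet> z = (cj b \<star> a) \<bullet> z"
      using V by (simp add: cj_def mul_simps one_left inner_diff_left)
    finally show ?thesis by simp
  qed
qed (use assms inD j in \<open>simp_all add: V_closed\<close>)

end

lemma embedding_double:
  fixes \<Phi> :: "'f::euclidean_space \<Rightarrow> 'a"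
  assumes emb: "embedding m k \<Phi>" and j: "j \<in> V" "norm j = 1" and orth: "\<And>x. j \<bullet> \<Phi> x = 0"
  shows "embedding (cd_mult m k) (cd_cnj k) (\<lambda>(a, b). \<Phi> a + \<Phi> b \<star> j)"
proof -
  have lin: "linear \<Phi>" and ran: "\<Phi> x \<in> V" and nrm: "norm (\<Phi> x) = norm x" and one: "one \<in> range \<Phi>"
    and mult: "\<Phi> (m x y) = \<Phi> x \<star> \<Phi> y" and cnj: "\<Phi> (k x) = cj (\<Phi> x)" for x y
    using emb by (auto simp: embedding_def)
  let ?D = "range \<Phi>"
  have D: "?D \<subseteq> V" "\<forall>x\<in>?D. \<forall>y\<in>?D. x \<star> y \<in> ?D" "\<forall>x\<in>?D. cj x \<in> ?D"
    "\<forall>x\<in>?D. j \<bullet> x = 0"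
    using ran orth by (auto simp flip: mult cnj)
  note ctx = D(1,2,3) one j D(4)
  define \<Psi> where "\<Psi> = (\<lambda>(a, b). \<Phi> a + \<Phi> b \<star> j)"
  have "linear \<Psi>"
    by (rule linearI)
      (auto simp: \<Psi>_def linear_add[OF lin] linear_scale[OF lin] mul_simps scaleR_right_distrib)
  moreover have "range \<Psi> \<subseteq> V"
    using ran j by (auto simp: \<Psi>_def V_closed)
  moreover have "norm (\<Psi> z) = norm z" for z
  proof (cases z)
    case (Pair a b)
    have "orthogonal (\<Phi> a) (\<Phi> b \<star> j)"
      unfolding orthogonal_def using D_orthogonal_Dj[OF ctx, OF rangeI rangeI] by blast
    then have "(norm (\<Psi> z))\<^sup>2 = (norm z)\<^sup>2"
      using ran j by (simp add: Pair \<Psi>_def norm_add_Pythagorean norm_mul nrm norm_Pair)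
    then show ?thesis by (simp add: power2_eq_iff_nonneg)
  qed
  moreover have "one \<in> range \<Psi>"
  proof -
    obtain x where "one = \<Phi> x" using one by blast
    then have "one = \<Psi> (x, 0)"
      by (simp add: \<Psi>_def linear_0[OF lin] bilinear_lzero[OF bilinear_mul])
    then show ?thesis by blast
  qed
  moreover have "\<Psi> (cd_mult m k z w) = \<Psi> z \<star> \<Psi> w" for z w
  proof (cases z; cases w)
    fix a b c d assume zw: "z = (a, b)" "w = (c, d)"
    have "\<Phi> a \<star> (\<Phi> d \<star> j) = (\<Phi> d \<star> \<Phi> a) \<star> j" "(\<Phi> b \<star> j) \<star> \<Phi> c = (\<Phi> b \<star> cj (\<Phi> c)) \<star> j"
      "(\<Phi> b \<star> j) \<star> (\<Phi> d \<star> j) = - (cj (\<Phi> d) \<star> \<Phi> b)"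
      using double1[OF ctx, OF rangeI rangeI] double2[OF ctx, OF rangeI rangeI]
        double3[OF ctx, OF rangeI rangeI] by blast+
    then show ?thesis
      by (simp add: zw \<Psi>_def linear_add[OF lin] linear_diff[OF lin] mult cnj mul_simps)
  qed
  moreover have "\<Psi> (cd_cnj k z) = cj (\<Psi> z)" for z
  proof (cases z)
    case (Pair a b)
    have "cj (\<Phi> b \<star> j) = - (\<Phi> b \<star> j)"
      using cj_Dj[OF ctx, OF rangeI] by blast
    then show ?thesis
      by (simp add: Pair \<Psi>_def cnj linear_neg[OF lin] mul_simps cj_def inner_add_left algebra_simps)
  qed
  ultimately show ?thesis
    unfolding \<Psi>_def[symmetric] by (simp add: embedding_def)
qed

text \<open>If the range is a proper subspace, \<open>V\<close> contains a unit vector orthogonal to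
  it, and adjoining that vector doubles the embedding.\<close>

lemma embedding_onto_or_double:
  fixes \<Phi> :: "'f::euclidean_space \<Rightarrow> 'a"
  assumes "embedding m k \<Phi>"
  shows "range \<Phi> = V \<or> (\<exists>\<Psi>. embedding (cd_mult m k) (cd_cnj k) \<Psi>)"
proof (rule disjCI)
  assume none: "\<not> (\<exists>\<Psi>. embedding (cd_mult m k) (cd_cnj k) \<Psi>)"
  have sub: "range \<Phi> \<subseteq> V" and lin: "linear \<Phi>" using assms by (auto simp: embedding_def)
  then have "subspace (range \<Phi>)" by (simp add: linear_subspace_image)
  show "range \<Phi> = V"
  proof (rule ccontr)
    assume "range \<Phi> \<noteq> V"
    then have "span (range \<Phi>) \<subset> span V"
      using sub unfolding span_eq_iff[THEN iffD2, OF \<open>subspace (range \<Phi>)\<close>] span_eq_iff[THEN iffD2, OF subspace_V] by blast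
    then obtain j where j: "j \<noteq> 0" "j \<in> span V" "\<And>y. y \<in> span (range \<Phi>) \<Longrightarrow> orthogonal j y"
      using orthogonal_to_subspace_exists_gen by blast
    let ?j = "(1 / norm j) *\<^sub>R j"
    have "embedding (cd_mult m k) (cd_cnj k) (\<lambda>(a, b). \<Phi> a + \<Phi> b \<star> ?j)"
    proof (rule embedding_double[OF assms])
      show "?j \<in> V" using j(2) subspace_scale[OF subspace_V] by (simp add: span_eq_iff[THEN iffD2, OF subspace_V])
      show "norm ?j = 1" using j(1) by simp
      show "?j \<bullet> \<Phi> x = 0" for x using j(3)[of "\<Phi> x"] by (simp add: orthogonal_def span_base)
    qed
    with none show False by blast
  qed
qed

section \<open>The tower from the reals to the octonions\<close>

lemma embedding_real: "embedding (*) (\<lambda>x. x) (\<lambda>r. r *\<^sub>R one)"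
proof -
  have "linear (\<lambda>r. r *\<^sub>R one)"
    by (rule linearI) (simp_all add: scaleR_left_distrib)
  moreover have "one \<in> range (\<lambda>r. r *\<^sub>R one)"
    by (rule range_eqI[of _ _ 1]) simp
  moreover have "cj (r *\<^sub>R one) = r *\<^sub>R one" for r
    by (simp add: cj_def flip: scaleR_left_diff_distrib)
  moreover have "(x * y) *\<^sub>R one = (x *\<^sub>R one) \<star> (y *\<^sub>R one)" for x y
    by (simp add: mul_simps one_left one_V)
  moreover have "range (\<lambda>r. r *\<^sub>R one) \<subseteq> V" by (auto simp: V_closed)
  ultimately show ?thesis by (simp add: embedding_def norm_one)
qed

text \<open>The double of the reals consists of pairs; it has to be moved to the type
  \<open>complex\<close>, on which \<open>quat\<close> is built.\<close>

lemma embedding_complex: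
  assumes "embedding (cd_mult (*) (\<lambda>x. x)) (cd_cnj (\<lambda>x::real. x)) \<Psi>"
  shows "embedding (*) cnj (\<lambda>z. \<Psi> (Re z, Im z))"
proof -
  have \<Psi>: "linear \<Psi>" "\<And>x. \<Psi> x \<in> V" "\<And>x. norm (\<Psi> x) = norm x" "one \<in> range \<Psi>"
    "\<And>x y. \<Psi> x \<star> \<Psi> y = \<Psi> (cd_mult (*) (\<lambda>x. x) x y)" "\<And>x. cj (\<Psi> x) = \<Psi> (cd_cnj (\<lambda>x. x) x)"
    using assms by (auto simp: embedding_def)
  have "linear (\<lambda>z. \<Psi> (Re z, Im z))"
    by (rule linearI) (simp_all flip: linear_add[OF \<Psi>(1)] linear_scale[OF \<Psi>(1)])
  moreover have "one \<in> range (\<lambda>z. \<Psi> (Re z, Im z))"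
  proof -
    obtain x y where "one = \<Psi> (x, y)" using \<Psi>(4) by auto
    then show ?thesis by (intro image_eqI[of _ _ "Complex x y"]) auto
  qed
  moreover have "norm (\<Psi> (Re z, Im z)) = norm z" for z
    by (simp add: \<Psi>(3) norm_Pair cmod_def)
  moreover have "\<Psi> (Re (z * w), Im (z * w)) = \<Psi> (Re z, Im z) \<star> \<Psi> (Re w, Im w)" for z w
    by (simp add: \<Psi>(5) algebra_simps)
  moreover have "\<Psi> (Re (cnj z), Im (cnj z)) = cj (\<Psi> (Re z, Im z))" for z
    by (simp add: \<Psi>(6))
  ultimately show ?thesis
    unfolding embedding_def using \<Psi>(2) by blast
qed

text \<open>The sedenions have zero divisors, for instance \<open>(e1 + e10) (e4 - e15) = 0\<close>.\<close>

lemma no_embedding_sedenion: "\<not> embedding (cd_mult octo_mult octo_cnj) (cd_cnj octo_cnj) \<Psi>"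
proof
  assume "embedding (cd_mult octo_mult octo_cnj) (cd_cnj octo_cnj) \<Psi>"
  then have \<Psi>: "linear \<Psi>" "\<And>x. \<Psi> x \<in> V" "\<And>x. norm (\<Psi> x) = norm x"
    "\<And>x y. \<Psi> (cd_mult octo_mult octo_cnj x y) = \<Psi> x \<star> \<Psi> y"
    by (auto simp: embedding_def)
  let ?x = "(((\<i>, 0), 0), ((0, 1), 0)) :: octo \<times> octo"
  let ?y = "((0, (1, 0)), (0, (0, - \<i>))) :: octo \<times> octo"
  have "cd_mult octo_mult octo_cnj ?x ?y = 0"
    by (simp add: octo_mult_def octo_cnj_def quat_mult_def quat_cnj_def zero_prod_def)
  then have "norm (\<Psi> ?x) * norm (\<Psi> ?y) = 0"
    by (metis \<Psi>(1,2,4) linear_0 norm_mul norm_zero)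
  then show False
    by (simp add: \<Psi>(3) zero_prod_def)
qed

theorem hurwitz:
  "(\<exists>\<Phi>. embedding (*) (\<lambda>x::real. x) \<Phi> \<and> range \<Phi> = V) \<or>
   (\<exists>\<Phi>. embedding (*) cnj \<Phi> \<and> range \<Phi> = V) \<or>
   (\<exists>\<Phi>. embedding quat_mult quat_cnj \<Phi> \<and> range \<Phi> = V) \<or>
   (\<exists>\<Phi>. embedding octo_mult octo_cnj \<Phi> \<and> range \<Phi> = V)"
proof -
  let ?C1 = "\<exists>\<Phi>. embedding (*) (\<lambda>x::real. x) \<Phi> \<and> range \<Phi> = V"
  let ?C2 = "\<exists>\<Phi>. embedding (*) cnj \<Phi> \<and> range \<Phi> = V"
  let ?C4 = "\<exists>\<Phi>. embedding quat_mult quat_cnj \<Phi> \<and> range \<Phi> = V"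
  let ?C8 = "\<exists>\<Phi>. embedding octo_mult octo_cnj \<Phi> \<and> range \<Phi> = V"
  have O: ?C8 if "embedding octo_mult octo_cnj X" for X
    using embedding_onto_or_double[OF that] no_embedding_sedenion that by metis
  have H: "?C4 \<or> ?C8" if "embedding quat_mult quat_cnj X" for X
    using embedding_onto_or_double[OF that]
  proof
    assume "\<exists>\<Psi>. embedding (cd_mult quat_mult quat_cnj) (cd_cnj quat_cnj) \<Psi>"
    then show ?thesis unfolding octo_mult_def[symmetric] octo_cnj_def[symmetric]
      using O by metis
  qed (use that in metis)
  have C: "?C2 \<or> ?C4 \<or> ?C8" if "embedding (*) cnj X" for X
    using embedding_onto_or_double[OF that]
  proof
    assume "\<exists>\<Psi>. embedding (cd_mult (*) cnj) (cd_cnj cnj) \<Psi>"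
    then show ?thesis unfolding quat_mult_def[symmetric] quat_cnj_def[symmetric]
      using H by metis
  qed (use that in metis)
  show ?thesis
    using embedding_onto_or_double[OF embedding_real]
  proof
    assume "range (\<lambda>r. r *\<^sub>R one) = V"
    then have ?C1 by (intro exI[of _ "\<lambda>r. r *\<^sub>R one"] conjI embedding_real)
    then show ?thesis ..
  next
    assume "\<exists>\<Psi>. embedding (cd_mult (*) (\<lambda>x. x)) (cd_cnj (\<lambda>x::real. x)) \<Psi>"
    then obtain \<Psi> where "embedding (cd_mult (*) (\<lambda>x. x)) (cd_cnj (\<lambda>x::real. x)) \<Psi>" ..
    from C[OF embedding_complex[OF this]] show ?thesis by (rule disjI2)
  qed
qed

end

section \<open>The algebra of an eigencubic in normal form\<close>

lemma orthonormal_basis_inner: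
  fixes S :: "'a::euclidean_space set"
  assumes "subspace S"
  obtains C where "card C = dim S" "\<forall>c\<in>C. norm c = 1" "C \<subseteq> S"
    "\<forall>x\<in>S. x \<bullet> x = (\<Sum>c\<in>C. (x \<bullet> c)\<^sup>2)"
proof -
  obtain C where C: "C \<subseteq> S" "pairwise orthogonal C" "\<And>x. x \<in> C \<Longrightarrow> norm x = 1"
    "independent C" "card C = dim S" "span C = S"
    using orthonormal_basis_subspace[OF assms] by metis
  have fin: "finite C" using C(4) by (rule independent_imp_finite)
  have "x \<bullet> x = (\<Sum>c\<in>C. (x \<bullet> c)\<^sup>2)" if "x \<in> S" for x
  proof -
    have "x = (\<Sum>c\<in>C. (x \<bullet> c) *\<^sub>R c)"
      using orthonormal_basis_expand[OF C(2,3) _ fin] that C(6) by simp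
    then have "x \<bullet> x = x \<bullet> (\<Sum>c\<in>C. (x \<bullet> c) *\<^sub>R c)" by simp
    then show ?thesis by (simp add: inner_sum_right power2_eq_square)
  qed
  with C fin show thesis using that by blast
qed

text \<open>After swapping the sums, each \<open>c\<close> contributes its squared norm 1. This
  turns traces over \<open>Basis\<close> into dimensions.\<close>

lemma sum_Basis_inner_sum:
  fixes C :: "'a::euclidean_space set"
  assumes "\<forall>c\<in>C. norm c = 1"
  shows "(\<Sum>b\<in>Basis. \<Sum>c\<in>C. (b \<bullet> c)\<^sup>2) = card C"
proof -
  have "(\<Sum>b\<in>Basis. (b \<bullet> c)\<^sup>2) = c \<bullet> c" for c :: 'a
    by (subst euclidean_inner) (simp add: power2_eq_square inner_commute)
  then have "(\<Sum>b\<in>Basis. \<Sum>c\<in>C. (b \<bullet> c)\<^sup>2) = (\<Sum>c\<in>C. c \<bullet> c)"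
    by (subst sum.swap) simp
  also have "\<dots> = (\<Sum>c\<in>C. 1)"
    using assms by (intro sum.cong) (auto simp: norm_eq_1)
  finally show ?thesis by simp
qed

text \<open>Polarisation: comparing \<open>x + y\<close> with \<open>x - y\<close> isolates
  \<open>M x x \<bullet> y\<close>, and a second polarisation separates the two equal
  arguments.\<close>

lemma symmetric_algebra_zero_on:
  assumes M: "symmetric_algebra M" and S: "subspace S"
    and 0: "\<And>x. x \<in> S \<Longrightarrow> M x x \<bullet> x = 0" and "x \<in> S" "y \<in> S" "z \<in> S"
  shows "M x y \<bullet> z = 0"
proof -
  note alg_simps = symmetric_algebra_simps[OF M] inner_add_left inner_add_right inner_diff_left inner_diff_right
  have comm: "M x y = M y x" and inv: "M x y \<bullet> z = M x z \<bullet> y" for x y z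
    by (rule symmetric_algebra_comm[OF M], rule symmetric_algebra_inner[OF M])
  have *: "M x x \<bullet> y = 0" if "x \<in> S" "y \<in> S" for x y
    using 0[of "x + y"] 0[of "x - y"] 0[of x] 0[of y] that S comm[of y x] inv[of x y x] inv[of y x y]
    by (simp add: subspace_add subspace_diff alg_simps)
  have "M (x + y) (x + y) \<bullet> z = 0" "M x x \<bullet> z = 0" "M y y \<bullet> z = 0"
    using * assms(4-6) S by (simp_all add: subspace_add)
  then show ?thesis by (simp add: alg_simps comm[of y x])
qed

text \<open>Subtracting the values at \<open>t\<close> and \<open>-t\<close> removes the even
  coefficients; the points 1, 2, 3 then determine the odd ones.\<close>

lemma odd_coefficients:
  fixes c0 :: real
  assumes "\<And>t. c5 * t ^ 5 + c4 * t ^ 4 + c3 * t ^ 3 + c2 * t\<^sup>2 + c1 * t + c0 = 0"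
  shows "c5 = 0" "c3 = 0" "c1 = 0"
proof -
  note t = assms[of 1] assms[of "-1"] assms[of 2] assms[of "-2"] assms[of 3] assms[of "-3"]
  show "c5 = 0" using t by simp
  show "c3 = 0" using t by simp
  show "c1 = 0" using t by simp
qed

text \<open>The normal form with \<eta> = 0, rewritten for the product: \<psi> stands for \<psi>102,
  and of its properties only the degrees 1 and 2 are kept. \<open>eigen\<close> is the eigenvalue
  equation with L expressed through \<open>M\<close>.\<close>

locale eigen_algebra =
  fixes M :: "'a::euclidean_space \<Rightarrow> 'a \<Rightarrow> 'a" and e V1 V3 and \<psi> :: "'a \<Rightarrow> 'a \<Rightarrow> real" and lam
  assumes M: "symmetric_algebra M" and dec: "orthogonal_decomposition e V1 {0} V3"
    and cubic: "\<xi> \<in> V1 \<Longrightarrow> \<zeta> \<in> V3 \<Longrightarrow>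
      M (t *\<^sub>R e + \<xi> + \<zeta>) (t *\<^sub>R e + \<xi> + \<zeta>) \<bullet> (t *\<^sub>R e + \<xi> + \<zeta>)
        = t ^ 3 - 3 * t * (\<xi> \<bullet> \<xi>) + 3 / 2 * t * (\<zeta> \<bullet> \<zeta>) + \<psi> \<xi> \<zeta>"
    and \<psi>: "\<xi> \<in> V1 \<Longrightarrow> \<zeta> \<in> V3 \<Longrightarrow> \<psi> (r *\<^sub>R \<xi>) (s *\<^sub>R \<zeta>) = r * s\<^sup>2 * \<psi> \<xi> \<zeta>"
    and lam: "lam \<noteq> 0"
    and eigen: "54 * (M x x \<bullet> M x x) * (\<Sum>b\<in>Basis. M x b \<bullet> b) - 54 * (M x (M x x) \<bullet> M x x)
       = lam * (x \<bullet> x) * (M x x \<bullet> x)"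
begin

lemma comm: "M x y = M y x" and inv: "M x y \<bullet> z = M x z \<bullet> y"
  by (rule symmetric_algebra_comm[OF M], rule symmetric_algebra_inner[OF M])

lemmas alg_simps = symmetric_algebra_simps[OF M] inner_add_left inner_add_right inner_diff_left inner_diff_right

lemma ee [simp]: "e \<bullet> e = 1" and V1: "subspace V1" and V3: "subspace V3"
  using dec by (simp_all add: orthogonal_decomposition_def norm_eq_1)

lemma orth: "\<xi> \<in> V1 \<Longrightarrow> e \<bullet> \<xi> = 0" "\<xi> \<in> V1 \<Longrightarrow> \<xi> \<bullet> e = 0" "\<zeta> \<in> V3 \<Longrightarrow> e \<bullet> \<zeta> = 0" "\<zeta> \<in> V3 \<Longrightarrow> \<zeta> \<bullet> e = 0"
  "\<xi> \<in> V1 \<Longrightarrow> \<zeta> \<in> V3 \<Longrightarrow> \<xi> \<bullet> \<zeta> = 0" "\<xi> \<in> V1 \<Longrightarrow> \<zeta> \<in> V3 \<Longrightarrow> \<zeta> \<bullet> \<xi> = 0"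
  using dec subspace_0[OF V1] subspace_0[OF V3]
  by (auto simp: orthogonal_decomposition_def orthogonal_def inner_commute)

lemma decompose:
  obtains t \<xi> \<zeta> where "x = t *\<^sub>R e + \<xi> + \<zeta>" "\<xi> \<in> V1" "\<zeta> \<in> V3"
proof -
  have "\<exists>t. \<exists>\<xi>\<in>V1. \<exists>\<eta>\<in>{0}. \<exists>\<zeta>\<in>V3. x = t *\<^sub>R e + \<xi> + \<eta> + \<zeta>"
    using dec unfolding orthogonal_decomposition_def by blast
  then show thesis using that by auto
qed

lemma mem_V1I: "x \<bullet> e = 0 \<Longrightarrow> (\<And>\<zeta>. \<zeta> \<in> V3 \<Longrightarrow> x \<bullet> \<zeta> = 0) \<Longrightarrow> x \<in> V1"
proof -
  assume *: "x \<bullet> e = 0" "\<And>\<zeta>. \<zeta> \<in> V3 \<Longrightarrow> x \<bullet> \<zeta> = 0"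
  obtain t \<xi> \<zeta> where x: "x = t *\<^sub>R e + \<xi> + \<zeta>" "\<xi> \<in> V1" "\<zeta> \<in> V3" by (rule decompose)
  have "t = 0" "\<zeta> = 0" using *(1) *(2)[OF x(3)] x(2,3) by (simp_all add: x(1) alg_simps orth)
  with x show "x \<in> V1" by simp
qed

lemma mem_V3I: "x \<bullet> e = 0 \<Longrightarrow> (\<And>\<xi>. \<xi> \<in> V1 \<Longrightarrow> x \<bullet> \<xi> = 0) \<Longrightarrow> x \<in> V3"
proof -
  assume *: "x \<bullet> e = 0" "\<And>\<xi>. \<xi> \<in> V1 \<Longrightarrow> x \<bullet> \<xi> = 0"
  obtain t \<xi> \<zeta> where x: "x = t *\<^sub>R e + \<xi> + \<zeta>" "\<xi> \<in> V1" "\<zeta> \<in> V3" by (rule decompose)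
  have "t = 0" "\<xi> = 0" using *(1) *(2)[OF x(2)] x(2,3) by (simp_all add: x(1) alg_simps orth)
  with x show "x \<in> V3" by simp
qed

lemma eqI:
  assumes "x \<bullet> e = y \<bullet> e" "\<And>\<xi>. \<xi> \<in> V1 \<Longrightarrow> x \<bullet> \<xi> = y \<bullet> \<xi>" "\<And>\<zeta>. \<zeta> \<in> V3 \<Longrightarrow> x \<bullet> \<zeta> = y \<bullet> \<zeta>"
  shows "x = y"
proof (rule vector_eq_rdot[THEN iffD1], rule allI)
  fix z
  obtain t \<xi> \<zeta> where "z = t *\<^sub>R e + \<xi> + \<zeta>" "\<xi> \<in> V1" "\<zeta> \<in> V3" by (rule decompose)
  then show "x \<bullet> z = y \<bullet> z" using assms by (simp add: inner_add_right)
qed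

lemma split_t:
  assumes "\<xi> \<in> V1" "\<zeta> \<in> V3"
  shows "M e e \<bullet> (\<xi> + \<zeta>) = 0" "M e (\<xi> + \<zeta>) \<bullet> (\<xi> + \<zeta>) = - (\<xi> \<bullet> \<xi>) + (\<zeta> \<bullet> \<zeta>) / 2"
    "M (\<xi> + \<zeta>) (\<xi> + \<zeta>) \<bullet> (\<xi> + \<zeta>) = \<psi> \<xi> \<zeta>" "M e e \<bullet> e = 1"
proof -
  define v where "v = \<xi> + \<zeta>"
  have sym: "M e v \<bullet> e = M e e \<bullet> v" "M v e = M e v" "M v v \<bullet> e = M e v \<bullet> v"
    using comm[of v e] inv[of e v e] inv[of v v e] by simp_all
  have *: "M (t *\<^sub>R e + v) (t *\<^sub>R e + v) \<bullet> (t *\<^sub>R e + v)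
      = t ^ 3 - 3 * t * (\<xi> \<bullet> \<xi>) + 3 / 2 * t * (\<zeta> \<bullet> \<zeta>) + \<psi> \<xi> \<zeta>" for t
    using cubic[OF assms, of t] by (simp add: v_def add.assoc)
  show "M (\<xi> + \<zeta>) (\<xi> + \<zeta>) \<bullet> (\<xi> + \<zeta>) = \<psi> \<xi> \<zeta>"
    using *[of 0] by (simp add: v_def)
  \<comment> \<open>Both sides are cubic polynomials in \<open>t\<close>, so four sample points
    suffice to compare coefficients.\<close>
  have "M e e \<bullet> v = 0 \<and> M e v \<bullet> v = - (\<xi> \<bullet> \<xi>) + (\<zeta> \<bullet> \<zeta>) / 2 \<and> M e e \<bullet> e = 1"
    using *[of 0] *[of 1] *[of "-1"] *[of 2] by (simp add: alg_simps sym)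
  then show "M e e \<bullet> (\<xi> + \<zeta>) = 0" "M e (\<xi> + \<zeta>) \<bullet> (\<xi> + \<zeta>) = - (\<xi> \<bullet> \<xi>) + (\<zeta> \<bullet> \<zeta>) / 2"
    "M e e \<bullet> e = 1" by (simp_all add: v_def)
qed

lemma zero_mem [simp]: "0 \<in> V1" "0 \<in> V3"
  using V1 V3 by (simp_all add: subspace_0)

section \<open>Peirce decomposition: \<open>M e\<close> acts as 1, -1 and 1/2 on the line of
  \<open>e\<close>, on \<open>V1\<close> and on \<open>V3\<close>\<close>

lemma Mee [simp]: "M e e = e"
  using split_t(1)[of _ 0] split_t(1)[of 0] split_t(4)[of 0 0] by (intro eqI) (simp_all add: orth)

lemma Me:
  assumes "\<xi> \<in> V1" "\<xi>' \<in> V1" "\<zeta> \<in> V3" "\<zeta>' \<in> V3"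
  shows "M e \<xi> \<bullet> \<xi>' = - (\<xi> \<bullet> \<xi>')" "M e \<zeta> \<bullet> \<zeta>' = (\<zeta> \<bullet> \<zeta>') / 2" "M e \<xi> \<bullet> \<zeta> = 0"
proof -
  have 1: "M e \<xi> \<bullet> \<xi> = - (\<xi> \<bullet> \<xi>)" if "\<xi> \<in> V1" for \<xi> using split_t(2)[OF that, of 0] by simp
  have 3: "M e \<zeta> \<bullet> \<zeta> = (\<zeta> \<bullet> \<zeta>) / 2" if "\<zeta> \<in> V3" for \<zeta> using split_t(2)[of 0, OF _ that] by simp
  show "M e \<xi> \<bullet> \<xi>' = - (\<xi> \<bullet> \<xi>')"
    using 1[of "\<xi> + \<xi>'"] 1[of \<xi>] 1[of \<xi>'] assms(1,2) V1 inv[of e \<xi>' \<xi>]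
    by (simp add: subspace_add alg_simps inner_commute)
  show "M e \<zeta> \<bullet> \<zeta>' = (\<zeta> \<bullet> \<zeta>') / 2"
    using 3[of "\<zeta> + \<zeta>'"] 3[of \<zeta>] 3[of \<zeta>'] assms(3,4) V3 inv[of e \<zeta>' \<zeta>]
    by (simp add: subspace_add alg_simps inner_commute)
  show "M e \<xi> \<bullet> \<zeta> = 0"
    using split_t(2)[OF assms(1,3)] 1[OF assms(1)] 3[OF assms(3)] inv[of e \<zeta> \<xi>]
    by (simp add: alg_simps)
qed

lemma Me_V1 [simp]: "\<xi> \<in> V1 \<Longrightarrow> M e \<xi> = - \<xi>" and Me_V1' [simp]: "\<xi> \<in> V1 \<Longrightarrow> M \<xi> e = - \<xi>"
proof -
  assume a: "\<xi> \<in> V1"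
  have "M e \<xi> \<bullet> e = 0" using inv[of e \<xi> e] a by (simp add: orth)
  then show "M e \<xi> = - \<xi>"
    using a Me(1)[of \<xi> _ 0 0] Me(3)[of \<xi> 0 _ 0] by (intro eqI) (simp_all add: orth)
  then show "M \<xi> e = - \<xi>" by (simp add: comm)
qed

lemma Me_V3 [simp]: "\<zeta> \<in> V3 \<Longrightarrow> M e \<zeta> = (1 / 2) *\<^sub>R \<zeta>" and Me_V3' [simp]: "\<zeta> \<in> V3 \<Longrightarrow> M \<zeta> e = (1 / 2) *\<^sub>R \<zeta>"
proof -
  assume a: "\<zeta> \<in> V3"
  have "M e \<zeta> \<bullet> e = 0" using inv[of e \<zeta> e] a by (simp add: orth)
  moreover have "M e \<zeta> \<bullet> \<xi> = 0" if "\<xi> \<in> V1" for \<xi> using inv[of e \<zeta> \<xi>] a that by (simp add: orth)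
  ultimately show "M e \<zeta> = (1 / 2) *\<^sub>R \<zeta>"
    using a Me(2)[of 0 0 \<zeta>] by (intro eqI) (simp_all add: orth)
  then show "M \<zeta> e = (1 / 2) *\<^sub>R \<zeta>" by (simp add: comm)
qed

text \<open>\<psi> is even in \<zeta>, so the part of the form odd in \<zeta> vanishes; that part is
  \<open>3 * (M \<xi> \<xi> \<bullet> \<zeta>)\<close> plus the cube of \<zeta>, and the cube is 0
  as well. Polarising in \<xi> gives the general case.\<close>

lemma M_V1_V1_V3:
  assumes "\<xi> \<in> V1" "\<xi>' \<in> V1" "\<zeta> \<in> V3"
  shows "M \<xi> \<xi>' \<bullet> \<zeta> = 0"
proof -
  have zero: "M \<xi> \<xi> \<bullet> \<zeta> = 0" if "\<xi> \<in> V1" "\<zeta> \<in> V3" for \<xi> \<zeta>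
  proof -
    have "\<psi> \<xi> 0 = 0" "\<psi> 0 \<zeta> = 0" "\<psi> \<xi> (-\<zeta>) = \<psi> \<xi> \<zeta>"
      using \<psi>[OF that, of 1 0] \<psi>[OF that, of 0 1] \<psi>[OF that, of 1 "-1"] by simp_all
    then have "M \<xi> \<xi> \<bullet> \<xi> = 0" "M \<zeta> \<zeta> \<bullet> \<zeta> = 0"
      "M (\<xi> + \<zeta>) (\<xi> + \<zeta>) \<bullet> (\<xi> + \<zeta>) = M (\<xi> + - \<zeta>) (\<xi> + - \<zeta>) \<bullet> (\<xi> + - \<zeta>)"
      using split_t(3)[of \<xi> 0] split_t(3)[of 0 \<zeta>] split_t(3)[of \<xi> \<zeta>] split_t(3)[of \<xi> "-\<zeta>"] that V3
      by (simp_all add: subspace_neg)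
    then show ?thesis
      using comm[of \<zeta> \<xi>] inv[of \<xi> \<zeta> \<xi>] inv[of \<zeta> \<xi> \<zeta>] by (simp add: alg_simps)
  qed
  show ?thesis
    using zero[of "\<xi> + \<xi>'" \<zeta>] zero[of \<xi> \<zeta>] zero[of \<xi>' \<zeta>] assms V1 comm[of \<xi> \<xi>']
    by (simp add: subspace_add alg_simps)
qed

lemma \<psi>_zero: "\<xi> \<in> V1 \<Longrightarrow> \<psi> \<xi> 0 = 0" "\<zeta> \<in> V3 \<Longrightarrow> \<psi> 0 \<zeta> = 0"
  using \<psi>[of \<xi> 0 1 0] \<psi>[of 0 \<zeta> 0 1] by simp_all

lemma cube_zero: "\<xi> \<in> V1 \<Longrightarrow> M \<xi> \<xi> \<bullet> \<xi> = 0" "\<zeta> \<in> V3 \<Longrightarrow> M \<zeta> \<zeta> \<bullet> \<zeta> = 0"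
  using split_t(3)[of \<xi> 0] split_t(3)[of 0 \<zeta>] \<psi>_zero(1)[of \<xi>] \<psi>_zero(2)[of \<zeta>] by simp_all

lemma M_V1_V1: "\<xi> \<in> V1 \<Longrightarrow> \<xi>' \<in> V1 \<Longrightarrow> M \<xi> \<xi>' = - (\<xi> \<bullet> \<xi>') *\<^sub>R e"
proof -
  assume a: "\<xi> \<in> V1" "\<xi>' \<in> V1"
  have "M \<xi> \<xi>' \<bullet> e = - (\<xi> \<bullet> \<xi>')" using inv[of \<xi> \<xi>' e] a by simp
  moreover have "M \<xi> \<xi>' \<bullet> z = 0" if "z \<in> V1" for z
    by (rule symmetric_algebra_zero_on[OF M V1 cube_zero(1) a that])
  ultimately show ?thesis
    using a M_V1_V1_V3 by (intro eqI) (simp_all add: orth)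
qed

lemma M_V1_V3: "\<xi> \<in> V1 \<Longrightarrow> \<zeta> \<in> V3 \<Longrightarrow> M \<xi> \<zeta> \<in> V3"
proof (rule mem_V3I)
  assume a: "\<xi> \<in> V1" "\<zeta> \<in> V3"
  show "M \<xi> \<zeta> \<bullet> e = 0" using inv[of \<xi> \<zeta> e] a by (simp add: orth)
  show "M \<xi> \<zeta> \<bullet> \<xi>' = 0" if "\<xi>' \<in> V1" for \<xi>' using inv[of \<xi> \<zeta> \<xi>'] M_V1_V1_V3 a that by simp
qed

text \<open>The subtracted multiple of \<open>e\<close> reflects the eigenvalue 1/2 of
  \<open>M e\<close> on \<open>V3\<close>; there is no \<open>V3\<close> component because cubes
  vanish on \<open>V3\<close>.\<close>

lemma M_V3_V3: "\<zeta> \<in> V3 \<Longrightarrow> \<zeta>' \<in> V3 \<Longrightarrow> M \<zeta> \<zeta>' - ((\<zeta> \<bullet> \<zeta>') / 2) *\<^sub>R e \<in> V1"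
proof (rule mem_V1I)
  assume a: "\<zeta> \<in> V3" "\<zeta>' \<in> V3"
  show "(M \<zeta> \<zeta>' - ((\<zeta> \<bullet> \<zeta>') / 2) *\<^sub>R e) \<bullet> e = 0"
    using inv[of \<zeta> \<zeta>' e] a by (simp add: alg_simps)
  show "(M \<zeta> \<zeta>' - ((\<zeta> \<bullet> \<zeta>') / 2) *\<^sub>R e) \<bullet> z = 0" if "z \<in> V3" for z
  proof -
    have "M \<zeta> \<zeta>' \<bullet> z = 0"
      by (rule symmetric_algebra_zero_on[OF M V3 cube_zero(2) a that])
    then show ?thesis using that by (simp add: inner_diff_left orth)
  qed
qed

text \<open>Of the polarised terms on \<open>V1\<close> + \<open>V3\<close> only those linear in
  \<xi> survive, and symmetry makes the three of them equal.\<close>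

lemma cubic_value:
  assumes "\<xi> \<in> V1" "\<zeta> \<in> V3"
  shows "M (t *\<^sub>R e + \<xi> + \<zeta>) (t *\<^sub>R e + \<xi> + \<zeta>) \<bullet> (t *\<^sub>R e + \<xi> + \<zeta>)
        = t ^ 3 - 3 * t * (\<xi> \<bullet> \<xi>) + 3 / 2 * t * (\<zeta> \<bullet> \<zeta>) + 3 * (M \<xi> \<zeta> \<bullet> \<zeta>)"
proof -
  have "M \<zeta> \<xi> = M \<xi> \<zeta>" by (rule comm)
  moreover from this have "M \<zeta> \<zeta> \<bullet> \<xi> = M \<xi> \<zeta> \<bullet> \<zeta>" "M \<xi> \<zeta> \<bullet> \<xi> = M \<xi> \<xi> \<bullet> \<zeta>"
    using inv[of \<zeta> \<zeta> \<xi>] inv[of \<xi> \<zeta> \<xi>] by simp_all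
  moreover have "M \<xi> \<xi> \<bullet> \<xi> = 0" "M \<xi> \<xi> \<bullet> \<zeta> = 0" using M_V1_V1 assms by (simp_all add: orth)
  moreover have "M \<zeta> \<zeta> \<bullet> \<zeta> = 0" using split_t(3)[of 0 \<zeta>] \<psi>_zero(2)[of \<zeta>] assms by simp
  ultimately have "\<psi> \<xi> \<zeta> = 3 * (M \<xi> \<zeta> \<bullet> \<zeta>)"
    using split_t(3)[OF assms] by (simp add: alg_simps)
  then show ?thesis using cubic[OF assms, of t] by simp
qed

text \<open>In orthonormal bases of the three summands both quadratic forms are diagonal, with
  weights 1, 1, 1 and 1, -1, 1/2; summing over \<open>Basis\<close> counts the basis
  vectors.\<close>

lemma dimension_trace:
  "DIM('a) = 1 + dim V1 + dim V3"
  "(\<Sum>b\<in>Basis. M e b \<bullet> b) = 1 - real (dim V1) + real (dim V3) / 2"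
proof -
  obtain C1 where C1: "card C1 = dim V1" "\<forall>c\<in>C1. norm c = 1" "C1 \<subseteq> V1"
    "\<forall>x\<in>V1. x \<bullet> x = (\<Sum>c\<in>C1. (x \<bullet> c)\<^sup>2)"
    using orthonormal_basis_inner[OF V1] by blast
  obtain C3 where C3: "card C3 = dim V3" "\<forall>c\<in>C3. norm c = 1" "C3 \<subseteq> V3"
    "\<forall>x\<in>V3. x \<bullet> x = (\<Sum>c\<in>C3. (x \<bullet> c)\<^sup>2)"
    using orthonormal_basis_inner[OF V3] by blast
  have b: "b \<bullet> b = (b \<bullet> e)\<^sup>2 + (\<Sum>c\<in>C1. (b \<bullet> c)\<^sup>2) + (\<Sum>c\<in>C3. (b \<bullet> c)\<^sup>2)"
    "M e b \<bullet> b = (b \<bullet> e)\<^sup>2 - (\<Sum>c\<in>C1. (b \<bullet> c)\<^sup>2) + (\<Sum>c\<in>C3. (b \<bullet> c)\<^sup>2) / 2" for b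
  proof -
    obtain t \<xi> \<zeta> where x: "b = t *\<^sub>R e + \<xi> + \<zeta>" "\<xi> \<in> V1" "\<zeta> \<in> V3" by (rule decompose)
    have "b \<bullet> e = t" using x by (simp add: alg_simps orth)
    moreover have "(\<Sum>c\<in>C1. (b \<bullet> c)\<^sup>2) = \<xi> \<bullet> \<xi>"
      unfolding C1(4)[rule_format, OF x(2)] using C1(3) x by (intro sum.cong) (auto simp: alg_simps orth subsetD)
    moreover have "(\<Sum>c\<in>C3. (b \<bullet> c)\<^sup>2) = \<zeta> \<bullet> \<zeta>"
      unfolding C3(4)[rule_format, OF x(3)] using C3(3) x by (intro sum.cong) (auto simp: alg_simps orth subsetD)
    moreover have "b \<bullet> b = t\<^sup>2 + \<xi> \<bullet> \<xi> + \<zeta> \<bullet> \<zeta>" "M e b \<bullet> b = t\<^sup>2 - \<xi> \<bullet> \<xi> + (\<zeta> \<bullet> \<zeta>) / 2"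
      unfolding x(1) using x(2,3) by (simp_all add: alg_simps orth power2_eq_square)
    ultimately show "b \<bullet> b = (b \<bullet> e)\<^sup>2 + (\<Sum>c\<in>C1. (b \<bullet> c)\<^sup>2) + (\<Sum>c\<in>C3. (b \<bullet> c)\<^sup>2)"
    "M e b \<bullet> b = (b \<bullet> e)\<^sup>2 - (\<Sum>c\<in>C1. (b \<bullet> c)\<^sup>2) + (\<Sum>c\<in>C3. (b \<bullet> c)\<^sup>2) / 2" by simp_all
  qed
  have e: "(\<Sum>b\<in>Basis. (b \<bullet> e)\<^sup>2) = 1"
    using sum_Basis_inner_sum[of "{e}"] by (simp add: norm_eq_1)
  have "real DIM('a) = (\<Sum>b\<in>(Basis :: 'a set). b \<bullet> b)" by simp
  also have "\<dots> = 1 + real (dim V1) + real (dim V3)"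
    unfolding b(1) sum.distrib e sum_Basis_inner_sum[OF C1(2)] sum_Basis_inner_sum[OF C3(2)] C1(1) C3(1) ..
  finally show "DIM('a) = 1 + dim V1 + dim V3" by linarith
  show "(\<Sum>b\<in>Basis. M e b \<bullet> b) = 1 - real (dim V1) + real (dim V3) / 2"
    unfolding b(2) sum.distrib sum_subtractf e sum_divide_distrib[symmetric]
      sum_Basis_inner_sum[OF C1(2)] sum_Basis_inner_sum[OF C3(2)] C1(1) C3(1) ..
qed

text \<open>The coefficients of \<open>t\<^sup>5\<close>, \<open>t\<^sup>3\<close> and \<open>t\<close> in the eigenvalue equation at \<open>t e + \<xi> + \<zeta>\<close>. Only
  these are informative: the even ones involve the unknown traces of \<open>M \<xi>\<close> and \<open>M \<zeta>\<close>.\<close>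

lemma coefficients:
  fixes \<xi> \<zeta> defines "\<tau> \<equiv> \<Sum>b\<in>Basis. M e b \<bullet> b"
  defines "a \<equiv> \<xi> \<bullet> \<xi>" and "b \<equiv> \<zeta> \<bullet> \<zeta>" and "d \<equiv> M \<xi> \<zeta> \<bullet> M \<xi> \<zeta>" and "Q \<equiv> M \<zeta> \<zeta> - ((\<zeta> \<bullet> \<zeta>) / 2) *\<^sub>R e"
  assumes "\<xi> \<in> V1" "\<zeta> \<in> V3"
  shows "lam = 54 * \<tau> - 54"
    "108 * \<tau> * (a + b) + 108 * a - 135 * b = lam * (5 / 2 * b - 2 * a)"
    "54 * \<tau> * (a\<^sup>2 + b\<^sup>2 / 4 + Q \<bullet> Q - a * b + 4 * d)
       - (81 / 2 * b\<^sup>2 - 162 * a\<^sup>2 - 108 * d + 54 * (Q \<bullet> Q)) = lam * (a + b) * (3 / 2 * b - 3 * a)"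
proof -
  define N c m k where "N = M \<xi> \<zeta>" and "c = N \<bullet> \<zeta>" and "m = M \<xi> N \<bullet> N" and "k = M Q \<zeta> \<bullet> N"
  define q where "q = Q \<bullet> Q"
  define \<kappa> where "\<kappa> = (\<Sum>b\<in>Basis. M (\<xi> + \<zeta>) b \<bullet> b)"
  have mem: "\<xi> \<in> V1" "\<zeta> \<in> V3" "N \<in> V3" "Q \<in> V1"
    using assms(6,7) M_V1_V3 M_V3_V3 by (auto simp: N_def Q_def)
  have N: "M \<xi> \<zeta> = N" "M \<zeta> \<xi> = N" and Q: "M \<zeta> \<zeta> = (b / 2) *\<^sub>R e + Q"
    by (simp_all add: N_def comm Q_def b_def)
  have d: "N \<bullet> N = d" by (simp add: d_def N_def)
  have inn: "\<zeta> \<bullet> N = c" "\<xi> \<bullet> Q = c" "Q \<bullet> \<xi> = c" "M \<xi> N \<bullet> \<zeta> = d" "M Q \<zeta> \<bullet> \<zeta> = q"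
  proof -
    show "\<zeta> \<bullet> N = c" by (simp add: c_def inner_commute)
    have "Q \<bullet> \<xi> = M \<zeta> \<zeta> \<bullet> \<xi>" using mem by (simp add: Q_def alg_simps orth)
    then show "Q \<bullet> \<xi> = c" using inv[of \<zeta> \<zeta> \<xi>] N by (simp add: c_def)
    then show "\<xi> \<bullet> Q = c" by (simp add: inner_commute)
    show "M \<xi> N \<bullet> \<zeta> = d" using inv[of \<xi> N \<zeta>] N d by simp
    have "M Q \<zeta> \<bullet> \<zeta> = M \<zeta> \<zeta> \<bullet> Q" using comm[of Q \<zeta>] inv[of \<zeta> Q \<zeta>] by simp
    then show "M Q \<zeta> \<bullet> \<zeta> = q" using mem by (simp add: Q q_def alg_simps orth)
  qed
  \<comment> \<open>The constant term of the squared norm of \<open>M x x\<close> as a polynomial in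
    \<open>t\<close>; its terms linear in \<open>t\<close> cancel.\<close>
  define s where "s = a\<^sup>2 + b\<^sup>2 / 4 + q - a * b + 4 * d"
  \<comment> \<open>\<kappa>, \<open>c\<close>, \<open>m\<close> and \<open>k\<close> occur only
    beside even powers of \<open>t\<close>, so they drop out without being computed.\<close>
  have "(54 * \<tau> - 54 - lam) * t ^ 5 + (54 * \<kappa>) * t ^ 4
     + (108 * \<tau> * (a + b) + 108 * a - 135 * b - lam * (5 / 2 * b - 2 * a)) * t ^ 3
     + (108 * \<kappa> * (a + b) - 162 * c - 3 * c * lam) * t\<^sup>2
     + (54 * \<tau> * s - (81 / 2 * b\<^sup>2 - 162 * a\<^sup>2 - 108 * d + 54 * q)
         - lam * (a + b) * (3 / 2 * b - 3 * a)) * t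
     + (54 * s * \<kappa> - 216 * (m + k) - 3 * c * (a + b) * lam) = 0" (is "?E t = 0") for t
  proof -
    \<comment> \<open>The components of \<open>M x x\<close> along \<open>e\<close>, in
      \<open>V1\<close> and in \<open>V3\<close>.\<close>
    define \<alpha> \<rho> \<sigma> where "\<alpha> = t\<^sup>2 - a + b / 2" and "\<rho> = (-2 * t) *\<^sub>R \<xi> + Q" and "\<sigma> = t *\<^sub>R \<zeta> + 2 *\<^sub>R N"
    define x y where "x = t *\<^sub>R e + \<xi> + \<zeta>" and "y = \<alpha> *\<^sub>R e + \<rho> + \<sigma>"
    have mem2: "\<rho> \<in> V1" "\<sigma> \<in> V3"
      unfolding \<rho>_def \<sigma>_def
      by (intro subspace_add V1 V3 subspace_scale mem)+
    have xx: "M x x = y"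
    proof -
      have "M x x = (t\<^sup>2 - a + b / 2) *\<^sub>R e + (-2 * t) *\<^sub>R \<xi> + Q + t *\<^sub>R \<zeta> + 2 *\<^sub>R N"
        unfolding x_def using mem
        by (simp add: alg_simps N Q M_V1_V1 flip: a_def)
          (simp add: algebra_simps power2_eq_square scaleR_2 flip: scaleR_add_left)
      then show ?thesis by (simp add: y_def \<alpha>_def \<rho>_def \<sigma>_def add.assoc)
    qed
    have rs: "\<rho> \<bullet> \<rho> = 4 * t\<^sup>2 * a - 4 * t * c + q" "\<sigma> \<bullet> \<sigma> = t\<^sup>2 * b + 4 * t * c + 4 * d"
      "\<xi> \<bullet> \<rho> = c - 2 * t * a" "\<zeta> \<bullet> \<sigma> = t * b + 2 * c"
      by (simp_all add: \<rho>_def \<sigma>_def alg_simps inn d flip: a_def b_def c_def q_def)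
        (simp_all add: power2_eq_square algebra_simps)
    have "y \<bullet> y = \<alpha>\<^sup>2 + \<rho> \<bullet> \<rho> + \<sigma> \<bullet> \<sigma>"
      using mem2 by (simp add: y_def alg_simps orth power2_eq_square)
    then have yy: "y \<bullet> y = t ^ 4 + 2 * (a + b) * t\<^sup>2 + s"
      unfolding rs \<alpha>_def s_def by (simp add: field_simps eval_nat_numeral)
    have s1: "M \<xi> \<sigma> \<bullet> \<sigma> = t\<^sup>2 * c + 4 * t * d + 4 * m"
    proof -
      have "M \<xi> \<zeta> \<bullet> N = d" "M \<xi> \<zeta> \<bullet> \<zeta> = c" using N d by (simp_all add: c_def)
      then show ?thesis
        by (simp add: \<sigma>_def alg_simps inn power2_eq_square algebra_simps flip: m_def)
    qed
    have s2: "M \<rho> \<zeta> \<bullet> \<sigma> = - (2 * t * (t * c + 2 * d)) + t * q + 2 * k"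
      by (simp add: \<rho>_def \<sigma>_def alg_simps N inn d flip: c_def k_def) (simp add: algebra_simps)
    have "M x y \<bullet> y = t * \<alpha>\<^sup>2 - t * (\<rho> \<bullet> \<rho>) + t * (\<sigma> \<bullet> \<sigma>) / 2 - 2 * \<alpha> * (\<xi> \<bullet> \<rho>)
        + \<alpha> * (\<zeta> \<bullet> \<sigma>) + M \<xi> \<sigma> \<bullet> \<sigma> + 2 * (M \<rho> \<zeta> \<bullet> \<sigma>)"
    proof -
      have X: "M \<xi> \<rho> \<bullet> \<sigma> = 0" "M \<xi> \<sigma> \<bullet> \<rho> = 0" "M \<xi> \<sigma> \<bullet> e = 0" "M \<rho> \<zeta> \<bullet> \<rho> = 0" "M \<rho> \<zeta> \<bullet> e = 0"
        "M \<zeta> \<sigma> \<bullet> e = (\<zeta> \<bullet> \<sigma>) / 2" "M \<zeta> \<sigma> \<bullet> \<rho> = M \<rho> \<zeta> \<bullet> \<sigma>" "M \<zeta> \<rho> = M \<rho> \<zeta>" "M \<xi> \<rho> \<bullet> e = - (\<xi> \<bullet> \<rho>)"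
        "M \<xi> \<rho> \<bullet> \<rho> = 0" "M \<zeta> \<sigma> \<bullet> \<sigma> = 0"
      proof -
        show "M \<xi> \<rho> \<bullet> \<sigma> = 0" "M \<xi> \<rho> \<bullet> e = - (\<xi> \<bullet> \<rho>)" "M \<xi> \<rho> \<bullet> \<rho> = 0"
          using mem mem2 by (simp_all add: M_V1_V1 orth)
        show "M \<xi> \<sigma> \<bullet> \<rho> = 0" "M \<xi> \<sigma> \<bullet> e = 0"
          using M_V1_V3[OF mem(1) mem2(2)] mem2 by (simp_all add: orth)
        show \<rho>\<zeta>: "M \<zeta> \<rho> = M \<rho> \<zeta>" by (rule comm)
        show "M \<rho> \<zeta> \<bullet> \<rho> = 0" "M \<rho> \<zeta> \<bullet> e = 0"
          using M_V1_V3[OF mem2(1) mem(2)] mem2 by (simp_all add: orth \<rho>\<zeta>)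
        show "M \<zeta> \<sigma> \<bullet> e = (\<zeta> \<bullet> \<sigma>) / 2"
          using inv[of \<zeta> \<sigma> e] mem by simp
        show "M \<zeta> \<sigma> \<bullet> \<rho> = M \<rho> \<zeta> \<bullet> \<sigma>"
          using inv[of \<zeta> \<sigma> \<rho>] by (simp add: \<rho>\<zeta>)
        show "M \<zeta> \<sigma> \<bullet> \<sigma> = 0"
        proof -
          have "M \<zeta> \<sigma> \<bullet> \<sigma> = (M \<zeta> \<sigma> - ((\<zeta> \<bullet> \<sigma>) / 2) *\<^sub>R e) \<bullet> \<sigma>" using mem2 by (simp add: alg_simps orth)
          also have "\<dots> = 0" using M_V3_V3[OF mem(2) mem2(2)] mem2 orth by blast
          finally show ?thesis .
        qed
      qed
      show ?thesis
        using mem mem2 unfolding x_def y_def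
        by (simp add: alg_simps orth X) (simp add: algebra_simps power2_eq_square)
    qed
    then have xyy: "M x y \<bullet> y = t ^ 5 + (5 / 2 * b - 2 * a) * t ^ 3 + 3 * c * t\<^sup>2
        + (3 / 4 * b\<^sup>2 - 3 * a\<^sup>2 + q - 2 * d) * t + 4 * (m + k)"
      unfolding rs s1 s2 \<alpha>_def by (simp add: field_simps eval_nat_numeral)
    have "(\<Sum>b\<in>Basis. M x b \<bullet> b) = t * \<tau> + \<kappa>"
      unfolding x_def \<tau>_def \<kappa>_def by (simp add: alg_simps sum.distrib sum_distrib_left)
    moreover have "x \<bullet> x = t\<^sup>2 + a + b"
      using mem by (simp add: x_def alg_simps orth a_def b_def power2_eq_square)
    moreover have "M x x \<bullet> x = t ^ 3 - 3 * t * a + 3 / 2 * t * b + 3 * c"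
      using cubic_value[OF mem(1,2), of t] by (simp add: x_def a_def b_def c_def N_def)
    ultimately have "54 * (y \<bullet> y) * (t * \<tau> + \<kappa>) - 54 * (M x y \<bullet> y)
        - lam * (t\<^sup>2 + a + b) * (t ^ 3 - 3 * t * a + 3 / 2 * t * b + 3 * c) = 0"
      using eigen[of x] xx by simp
    moreover have "?E t = 54 * (y \<bullet> y) * (t * \<tau> + \<kappa>) - 54 * (M x y \<bullet> y)
        - lam * (t\<^sup>2 + a + b) * (t ^ 3 - 3 * t * a + 3 / 2 * t * b + 3 * c)"
      unfolding yy xyy by (simp add: field_simps eval_nat_numeral)
    ultimately show ?thesis by simp
  qed
  note * = odd_coefficients[OF this]
  show "lam = 54 * \<tau> - 54"
    "108 * \<tau> * (a + b) + 108 * a - 135 * b = lam * (5 / 2 * b - 2 * a)"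
    "54 * \<tau> * (a\<^sup>2 + b\<^sup>2 / 4 + Q \<bullet> Q - a * b + 4 * d)
       - (81 / 2 * b\<^sup>2 - 162 * a\<^sup>2 - 108 * d + 54 * (Q \<bullet> Q)) = lam * (a + b) * (3 / 2 * b - 3 * a)"
    using * by (simp_all add: s_def q_def)
qed

section \<open>Consequences of the three coefficient equations\<close>

lemma lam_eq: "lam = 54 * (\<Sum>b\<in>Basis. M e b \<bullet> b) - 54"
  using coefficients(1)[OF zero_mem] .

lemma ex_nonzero: "(\<exists>\<xi>\<in>V1. \<xi> \<noteq> 0) \<or> (\<exists>\<zeta>\<in>V3. \<zeta> \<noteq> 0)"
proof (rule ccontr)
  assume "\<not> ?thesis"
  then have "V1 = {0}" "V3 = {0}" using zero_mem by blast+
  then have "lam = 0" using lam_eq dimension_trace(2) by simp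
  with lam show False ..
qed

text \<open>Inserting \<open>lam_eq\<close> into the coefficient of \<open>t^3\<close> and setting
  one of \<xi>, \<zeta> to 0 leaves a nonzero multiple of the trace times the squared norm of the
  other.\<close>

lemma trace_e: "(\<Sum>b\<in>Basis. M e b \<bullet> b) = 0"
  using ex_nonzero
proof
  assume "\<exists>\<xi>\<in>V1. \<xi> \<noteq> 0"
  then obtain \<xi> where "\<xi> \<in> V1" "\<xi> \<noteq> 0" by blast
  then have "(\<Sum>b\<in>Basis. M e b \<bullet> b) * (\<xi> \<bullet> \<xi>) = 0"
    using coefficients(2)[of \<xi> 0] by (simp add: lam_eq algebra_simps)
  with \<open>\<xi> \<noteq> 0\<close> show ?thesis by simp
next
  assume "\<exists>\<zeta>\<in>V3. \<zeta> \<noteq> 0"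
  then obtain \<zeta> where "\<zeta> \<in> V3" "\<zeta> \<noteq> 0" by blast
  then have "(\<Sum>b\<in>Basis. M e b \<bullet> b) * (\<zeta> \<bullet> \<zeta>) = 0"
    using coefficients(2)[of 0 \<zeta>] by (simp add: lam_eq algebra_simps)
  with \<open>\<zeta> \<noteq> 0\<close> show ?thesis by simp
qed

lemma dim_V3: "dim V3 + 2 = 2 * dim V1"
  using dimension_trace(2) trace_e by simp

text \<open>With trace 0 and eigenvalue -54, the coefficient of \<open>t\<close> at \<xi> = 0
  determines the \<open>V1\<close> part of \<open>M \<zeta> \<zeta>\<close>, and then the general
  coefficient determines \<open>M \<xi> \<zeta>\<close>. The \<open>e\<close> part of
  \<open>M \<zeta> \<zeta>\<close> adds 1/4 to the 3/4 of the \<open>V1\<close> part.\<close>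

lemma square_norms:
  assumes "\<xi> \<in> V1" "\<zeta> \<in> V3"
  shows "M \<xi> \<zeta> \<bullet> M \<xi> \<zeta> = 3 / 4 * (\<xi> \<bullet> \<xi>) * (\<zeta> \<bullet> \<zeta>)" "M \<zeta> \<zeta> \<bullet> M \<zeta> \<zeta> = (\<zeta> \<bullet> \<zeta>)\<^sup>2"
proof -
  let ?Q = "M \<zeta> \<zeta> - ((\<zeta> \<bullet> \<zeta>) / 2) *\<^sub>R e"
  have lam: "lam = - 54" using lam_eq trace_e by simp
  have Q: "?Q \<bullet> ?Q = 3 / 4 * (\<zeta> \<bullet> \<zeta>)\<^sup>2"
    using coefficients(3)[of 0 \<zeta>] assms
    by (simp add: lam trace_e alg_simps power2_eq_square)
  show "M \<xi> \<zeta> \<bullet> M \<xi> \<zeta> = 3 / 4 * (\<xi> \<bullet> \<xi>) * (\<zeta> \<bullet> \<zeta>)"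
    using coefficients(3)[OF assms, unfolded Q lam trace_e]
    by (simp add: power2_eq_square algebra_simps)
  have "M \<zeta> \<zeta> = ((\<zeta> \<bullet> \<zeta>) / 2) *\<^sub>R e + ?Q" by simp
  moreover have "?Q \<in> V1" using assms M_V3_V3 by blast
  ultimately obtain q where q: "M \<zeta> \<zeta> = ((\<zeta> \<bullet> \<zeta>) / 2) *\<^sub>R e + q" "q = ?Q" "q \<in> V1" by blast
  have "M \<zeta> \<zeta> \<bullet> M \<zeta> \<zeta> = ((\<zeta> \<bullet> \<zeta>) / 2)\<^sup>2 + q \<bullet> q"
    unfolding q(1) using q(3) by (simp add: alg_simps orth power2_eq_square)
  then show "M \<zeta> \<zeta> \<bullet> M \<zeta> \<zeta> = (\<zeta> \<bullet> \<zeta>)\<^sup>2" unfolding q(2) Q by (simp add: power_divide)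
qed

end

section \<open>Trialities\<close>

text \<open>\<open>N z\<close> is self-adjoint, so polarising the norm hypothesis shows that its
  square acts on \<open>A\<close> as a scalar. The intermediate space \<open>B\<close> allows
  \<open>N z\<close> to exchange two spaces.\<close>

lemma symmetric_algebra_square:
  assumes N: "symmetric_algebra N" and A: "subspace A"
    and AB: "\<And>x. x \<in> A \<Longrightarrow> N z x \<in> B" and BA: "\<And>y. y \<in> B \<Longrightarrow> N z y \<in> A"
    and norm: "\<And>x. x \<in> A \<Longrightarrow> N z x \<bullet> N z x = c * (x \<bullet> x)" and x: "x \<in> A"
  shows "N z (N z x) = c *\<^sub>R x"
proof -
  have inv: "N x y \<bullet> z = N x z \<bullet> y" for x y z
    by (rule symmetric_algebra_inner[OF N])
  have *: "N z (N z x) \<bullet> y = c * (x \<bullet> y)" if y: "y \<in> A" for y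
  proof -
    have "N z (x + y) \<bullet> N z (x + y) = c * ((x + y) \<bullet> (x + y))"
      using A x y by (intro norm subspace_add)
    then have "N z x \<bullet> N z y = c * (x \<bullet> y)"
      using norm[OF x] norm[OF y]
      by (simp add: symmetric_algebra_simps[OF N] inner_add_left inner_add_right inner_commute algebra_simps)
    then show ?thesis using inv[of z "N z x" y] by (simp add: inner_commute)
  qed
  let ?d = "N z (N z x) - c *\<^sub>R x"
  have "?d \<in> A" using A x AB BA by (intro subspace_diff subspace_scale) auto
  then have "?d \<bullet> ?d = 0" unfolding inner_diff_left[of "N z (N z x)"] by (simp add: *)
  then show ?thesis by simp
qed

definition isometry_onto :: "('b::real_inner \<Rightarrow> 'a::real_inner) \<Rightarrow> 'a set \<Rightarrow> bool" where
  "isometry_onto \<phi> S \<longleftrightarrow> linear \<phi> \<and> (\<forall>x. norm (\<phi> x) = norm x) \<and> range \<phi> = S"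

lemma isometry_onto_inner: "isometry_onto \<phi> S \<Longrightarrow> \<phi> x \<bullet> \<phi> y = x \<bullet> y"
  unfolding isometry_onto_def by (simp add: dot_norm flip: linear_add)

text \<open>The three products are three readings of one trilinear form on \<open>A\<close>,
  \<open>B\<close> and \<open>C\<close>. The unit vectors \<open>a0\<close> and \<open>b0\<close>
  are the base points from which a unit is made.\<close>

locale triality =
  fixes N :: "'a::euclidean_space \<Rightarrow> 'a \<Rightarrow> 'a" and A B C a0 b0
  assumes N: "symmetric_algebra N" and subspace: "subspace A" "subspace B" "subspace C"
    and AB: "x \<in> A \<Longrightarrow> y \<in> B \<Longrightarrow> N x y \<in> C" and AC: "x \<in> A \<Longrightarrow> z \<in> C \<Longrightarrow> N x z \<in> B"
    and BC: "y \<in> B \<Longrightarrow> z \<in> C \<Longrightarrow> N y z \<in> A"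
    and norm_AB: "x \<in> A \<Longrightarrow> y \<in> B \<Longrightarrow> norm (N x y) = norm x * norm y"
    and norm_AC: "x \<in> A \<Longrightarrow> z \<in> C \<Longrightarrow> norm (N x z) = norm x * norm z"
    and norm_BC: "y \<in> B \<Longrightarrow> z \<in> C \<Longrightarrow> norm (N y z) = norm y * norm z"
    and a0: "a0 \<in> A" "norm a0 = 1" and b0: "b0 \<in> B" "norm b0 = 1"
begin

lemma comm: "N x y = N y x"
  by (rule symmetric_algebra_comm[OF N])

lemma square:
  "b \<in> B \<Longrightarrow> N a0 (N a0 b) = b" "c \<in> C \<Longrightarrow> N a0 (N a0 c) = c"
  "a \<in> A \<Longrightarrow> N b0 (N b0 a) = a" "c \<in> C \<Longrightarrow> N b0 (N b0 c) = c"
proof -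
  have BA: "N b0 a \<in> C" "norm (N b0 a) = norm a" if "a \<in> A" for a
    using AB[OF that b0(1)] norm_AB[OF that b0(1)] b0(2) by (simp_all add: comm[of b0])
  note sq = symmetric_algebra_square[OF N, where c = 1, unfolded mult_1 scaleR_one]
  show "N a0 (N a0 b) = b" if "b \<in> B"
    by (rule sq[OF subspace(2), where B = C]) (simp_all add: AB AC norm_AB a0 that flip: norm_eq)
  show "N a0 (N a0 c) = c" if "c \<in> C"
    by (rule sq[OF subspace(3), where B = B]) (simp_all add: AB AC norm_AC a0 that flip: norm_eq)
  show "N b0 (N b0 a) = a" if "a \<in> A"
    by (rule sq[OF subspace(1), where B = C])
      (simp_all add: BA BC b0 that flip: norm_eq)
  show "N b0 (N b0 c) = c" if "c \<in> C"
    by (rule sq[OF subspace(3), where B = A])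
      (simp_all add: BA BC norm_BC b0 that flip: norm_eq)
qed

text \<open>\<open>N b0\<close> and \<open>N a0\<close> identify \<open>C\<close> with \<open>A\<close> and with \<open>B\<close>; transported along them, the product
  \<open>A \<times> B \<rightarrow> C\<close> becomes a composition algebra with unit \<open>N a0 b0\<close>.\<close>

definition mul :: "'a \<Rightarrow> 'a \<Rightarrow> 'a" where
  "mul x y = N (N b0 x) (N a0 y)"

sublocale composition_algebra C mul "N a0 b0"
proof
  note s = symmetric_algebra_simps[OF N]
  show "subspace C" by (rule subspace)
  show "bilinear mul"
    unfolding bilinear_def mul_def by (intro allI conjI linearI) (simp_all add: s)
  show "mul x y \<in> C" "norm (mul x y) = norm x * norm y" if "x \<in> C" "y \<in> C" for x y
    using that a0 b0 by (simp_all add: mul_def AB AC BC norm_AB norm_AC norm_BC)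
  show "N a0 b0 \<in> C" "norm (N a0 b0) = 1" using a0 b0 by (simp_all add: AB norm_AB)
  \<comment> \<open>\<open>N b0\<close> takes the unit to \<open>a0\<close>, and \<open>N a0\<close>
    squares to the identity on \<open>C\<close>; the right unit law is symmetric.\<close>
  show "mul (N a0 b0) x = x" if "x \<in> C" for x
    using square(3)[OF a0(1)] square(2)[OF that] by (simp add: mul_def comm[of a0 b0])
  show "mul x (N a0 b0) = x" if "x \<in> C" for x
    using square(1)[OF b0(1)] square(4)[OF that] by (simp add: mul_def comm[of _ b0])
qed

text \<open>\<alpha> and \<beta> invert the identifications behind \<open>mul\<close>, so
  \<open>N (\<alpha> z3) (\<beta> z1)\<close> becomes the image of \<open>m z3 z1\<close>. The
  conjugation in \<gamma> is there because the real part of a product is the inner product of one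
  factor with the conjugate of the other; \<open>re\<close> combines this with a cyclic rotation of
  the factors.\<close>

lemma parametrization:
  fixes \<Phi> :: "'f::euclidean_space \<Rightarrow> 'a"
  assumes emb: "embedding m k \<Phi>" and onto: "range \<Phi> = C"
    and re: "\<And>z1 z2 z3. m z3 z1 \<bullet> k z2 = re (m (m z1 z2) z3)"
  shows "\<exists>\<alpha> \<beta> \<gamma>. isometry_onto \<alpha> A \<and> isometry_onto \<beta> B \<and> isometry_onto \<gamma> C \<and>
    (\<forall>z1 z2 z3. N (\<alpha> z3) (\<beta> z1) \<bullet> \<gamma> z2 = re (m (m z1 z2) z3))"
proof (intro exI conjI allI)
  have lin: "linear \<Phi>" and mem: "\<Phi> x \<in> C" and nrm: "norm (\<Phi> x) = norm x"
    and mult: "\<Phi> (m x y) = mul (\<Phi> x) (\<Phi> y)" and cnj: "\<Phi> (k x) = cj (\<Phi> x)" for x y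
    using emb by (auto simp: embedding_def)
  have iso: "isometry_onto \<Phi> C" using lin nrm onto by (simp add: isometry_onto_def)
  have linN: "linear (\<lambda>z. N y (\<Phi> z))" for y
    by (rule linearI) (simp_all add: linear_add[OF lin] linear_scale[OF lin] symmetric_algebra_simps[OF N])
  have "range (\<lambda>z. N b0 (\<Phi> z)) = A"
  proof
    show "range (\<lambda>z. N b0 (\<Phi> z)) \<subseteq> A" using mem b0 BC by auto
    show "A \<subseteq> range (\<lambda>z. N b0 (\<Phi> z))"
    proof
      fix a assume a: "a \<in> A"
      then have "N b0 a \<in> range \<Phi>" using AB[OF a b0(1)] onto comm by simp
      then obtain z where "N b0 a = \<Phi> z" ..
      then show "a \<in> range (\<lambda>z. N b0 (\<Phi> z))" using square(3)[OF a] by (intro image_eqI[of _ _ z]) simp_all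
    qed
  qed
  then show "isometry_onto (\<lambda>z. N b0 (\<Phi> z)) A"
    using linN mem b0 by (simp add: isometry_onto_def norm_BC nrm)
  have "range (\<lambda>z. N a0 (\<Phi> z)) = B"
  proof
    show "range (\<lambda>z. N a0 (\<Phi> z)) \<subseteq> B" using mem a0 AC by auto
    show "B \<subseteq> range (\<lambda>z. N a0 (\<Phi> z))"
    proof
      fix b assume b: "b \<in> B"
      then have "N a0 b \<in> range \<Phi>" using AB[OF a0(1) b] onto by simp
      then obtain z where "N a0 b = \<Phi> z" ..
      then show "b \<in> range (\<lambda>z. N a0 (\<Phi> z))" using square(1)[OF b] by (intro image_eqI[of _ _ z]) simp_all
    qed
  qed
  then show "isometry_onto (\<lambda>z. N a0 (\<Phi> z)) B"
    using linN mem a0 by (simp add: isometry_onto_def norm_AC nrm)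
  have norm_cj: "norm (cj x) = norm x" for x
    using inner_cj[of x "cj x"] by (simp add: norm_eq)
  have "linear (\<lambda>z. \<Phi> (k z))"
    unfolding cnj cj_def
    by (rule linearI)
      (simp_all add: linear_add[OF lin] linear_scale[OF lin] inner_add_left algebra_simps)
  moreover have "range (\<lambda>z. \<Phi> (k z)) = C"
  proof
    show "range (\<lambda>z. \<Phi> (k z)) \<subseteq> C" using mem by auto
    show "C \<subseteq> range (\<lambda>z. \<Phi> (k z))"
    proof
      fix c assume "c \<in> C"
      then have "cj c \<in> range \<Phi>" using onto by simp
      then obtain z where "cj c = \<Phi> z" ..
      then show "c \<in> range (\<lambda>z. \<Phi> (k z))" by (intro image_eqI[of _ _ z]) (simp_all add: cnj flip: \<open>cj c = \<Phi> z\<close>)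
    qed
  qed
  ultimately show "isometry_onto (\<lambda>z. \<Phi> (k z)) C"
    by (simp add: isometry_onto_def cnj norm_cj nrm)
  show "N (N b0 (\<Phi> z3)) (N a0 (\<Phi> z1)) \<bullet> \<Phi> (k z2) = re (m (m z1 z2) z3)" for z1 z2 z3
    using isometry_onto_inner[OF iso, of "m z3 z1" "k z2"] re by (simp add: mult mul_def)
qed

end

section \<open>Real parts of triple products as inner products\<close>

lemma inner_real_triple: "(z3 * z1) \<bullet> z2 = z1 * z2 * (z3 :: real)"
  by simp

lemma inner_cnj_triple: "(z3 * z1) \<bullet> cnj z2 = Re (z1 * z2 * z3)"
  by (simp add: inner_complex_def algebra_simps)

lemma inner_quat_cnj_triple:
  "quat_mult z3 z1 \<bullet> quat_cnj z2 = quat_Re (quat_mult (quat_mult z1 z2) z3)"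
  by (cases z1; cases z2; cases z3)
    (simp add: quat_mult_def quat_cnj_def quat_Re_def inner_complex_def algebra_simps)

lemma inner_octo_cnj_triple:
  "octo_mult z3 z1 \<bullet> octo_cnj z2 = octo_Re (octo_mult (octo_mult z1 z2) z3)"
  by (cases z1; cases "fst z1"; cases "snd z1"; cases z2; cases "fst z2"; cases "snd z2";
      cases z3; cases "fst z3"; cases "snd z3")
    (simp add: octo_mult_def octo_cnj_def octo_Re_def quat_mult_def quat_cnj_def quat_Re_def
      inner_complex_def algebra_simps)

section \<open>Reduction to a composition algebra\<close>

text \<open>Parametrisations run from the model of \<open>g\<close> to that of \<open>f\<close>,
  opposite to \<open>U\<close> in \<open>congruent_forms\<close>; the inverse of \<open>S\<close>
  serves as \<open>U\<close>.\<close>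

lemma congruent_formsI:
  fixes f :: "'a::euclidean_space \<Rightarrow> real" and g :: "'b::euclidean_space \<Rightarrow> real"
  assumes S: "isometry_onto S UNIV" and c: "c \<noteq> 0" and f: "\<And>v. c * f (S v) = g v"
  shows "congruent_forms f g"
proof -
  have lin: "linear S" and surj: "surj S" using S by (auto simp: isometry_onto_def)
  have "x = 0" if "S x = 0" for x
    using S that unfolding isometry_onto_def by (metis norm_eq_zero)
  then have inj: "inj S" using lin by (simp add: linear_injective_0)
  have SU: "S (inv S x) = x" for x using surj by (rule surj_f_inv_f)
  have US: "inv S (S v) = v" for v using inj by (rule inv_f_f)
  have "linear (inv S)"
  proof (rule linearI)
    show "inv S (x + y) = inv S x + inv S y" for x y
      using US[of "inv S x + inv S y"] by (simp add: linear_add[OF lin] SU)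
    show "inv S (r *\<^sub>R x) = r *\<^sub>R inv S x" for r x
      using US[of "r *\<^sub>R inv S x"] by (simp add: linear_scale[OF lin] SU)
  qed
  moreover have "inv S v \<bullet> inv S w = v \<bullet> w" for v w
    using isometry_onto_inner[OF S, of "inv S v" "inv S w"] by (simp add: SU)
  moreover have "surj (inv S)" using inj by (simp add: inj_imp_surj_inv)
  moreover have "f x = 1 / c * g (inv S x)" for x
    using f[of "inv S x"] c by (simp add: SU field_simps)
  ultimately show ?thesis
    unfolding congruent_forms_def using c by (intro exI[of _ "inv S"] exI[of _ "1 / c"]) auto
qed

locale eigen_algebra_unit = eigen_algebra +
  fixes z0
  assumes z0: "z0 \<in> V1" "norm z0 = 1"
begin

text \<open>Normalised so that \<open>N \<xi>\<close> acts on \<open>V3\<close> by a symmetric orthogonal map for every unit vector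
  \<open>\<xi> \<in> V1\<close>. These maps form a Clifford system, and \<open>Ep\<close>, \<open>Em\<close> are the eigenspaces of \<open>N z0\<close>.\<close>

definition N :: "'a \<Rightarrow> 'a \<Rightarrow> 'a" where "N x y = (2 / sqrt 3) *\<^sub>R M x y"

definition "W = {w \<in> V1. w \<bullet> z0 = 0}"
definition "Ep = {u \<in> V3. N z0 u = u}"
definition "Em = {v \<in> V3. N z0 v = - v}"

lemma z0_inner [simp]: "z0 \<bullet> z0 = 1" using z0 by (simp add: norm_eq_1)

lemma N: "symmetric_algebra N"
  unfolding symmetric_algebra_def bilinear_def
  by (intro conjI allI linearI)
    (simp_all add: N_def alg_simps scaleR_add_right comm[of _ "_ :: 'a"] inv)

lemmas N_simps = symmetric_algebra_simps[OF N]

lemma N_comm: "N x y = N y x" and N_inv: "N x y \<bullet> z = N x z \<bullet> y"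
  by (rule symmetric_algebra_comm[OF N], rule symmetric_algebra_inner[OF N])

lemma M_N: "M x y \<bullet> z = sqrt 3 / 2 * (N x y \<bullet> z)"
  by (simp add: N_def)

lemma N_V3: "\<xi> \<in> V1 \<Longrightarrow> \<zeta> \<in> V3 \<Longrightarrow> N \<xi> \<zeta> \<in> V3"
  unfolding N_def using V3 by (intro subspace_scale M_V1_V3)

lemma norm_N: "\<xi> \<in> V1 \<Longrightarrow> \<zeta> \<in> V3 \<Longrightarrow> N \<xi> \<zeta> \<bullet> N \<xi> \<zeta> = (\<xi> \<bullet> \<xi>) * (\<zeta> \<bullet> \<zeta>)"
  by (simp add: N_def square_norms)

lemma N_N: "\<xi> \<in> V1 \<Longrightarrow> \<zeta> \<in> V3 \<Longrightarrow> N \<xi> (N \<xi> \<zeta>) = (\<xi> \<bullet> \<xi>) *\<^sub>R \<zeta>"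
  by (rule symmetric_algebra_square[OF N V3, where B = V3]) (simp_all add: N_V3 norm_N)

text \<open>\<open>N_N\<close> at \<open>z0 + w\<close>, minus its instances at \<open>z0\<close>
  and \<open>w\<close>; the cross term of the squared norm vanishes.\<close>

lemma clifford:
  assumes w: "w \<in> W" and "\<zeta> \<in> V3"
  shows "N z0 (N w \<zeta>) = - N w (N z0 \<zeta>)"
proof -
  have w: "w \<in> V1" "w \<bullet> z0 = 0" "z0 \<bullet> w = 0" using w by (simp_all add: W_def inner_commute)
  then have "z0 + w \<in> V1" using z0 V1 by (intro subspace_add)
  from N_N[OF this assms(2)] N_N[OF z0(1) assms(2)] N_N[OF w(1) assms(2)]
  have "N z0 (N w \<zeta>) + N w (N z0 \<zeta>) = 0"
    using w by (simp add: N_simps inner_add_left inner_add_right algebra_simps)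
  then show ?thesis by (simp add: eq_neg_iff_add_eq_0)
qed

lemma inner_decompose:
  "\<xi> \<in> V1 \<Longrightarrow> \<zeta> \<in> V3 \<Longrightarrow> (t *\<^sub>R e + \<xi> + \<zeta>) \<bullet> (t *\<^sub>R e + \<xi> + \<zeta>) = t\<^sup>2 + \<xi> \<bullet> \<xi> + \<zeta> \<bullet> \<zeta>"
  by (simp add: alg_simps orth power2_eq_square)

lemma subspaces: "subspace W" "subspace Ep" "subspace Em"
  unfolding W_def Ep_def Em_def subspace_def using V1 V3
  by (auto simp: subspace_def N_simps inner_add_left)

lemma W_V1: "w \<in> W \<Longrightarrow> w \<in> V1" and Ep_V3: "u \<in> Ep \<Longrightarrow> u \<in> V3" and Em_V3: "v \<in> Em \<Longrightarrow> v \<in> V3"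
  by (simp_all add: W_def Ep_def Em_def)

lemma Ep_Em: "u \<in> Ep \<Longrightarrow> v \<in> Em \<Longrightarrow> u \<bullet> v = 0"
  using N_inv[of z0 u v] by (simp add: Ep_def Em_def inner_commute)

text \<open>\<open>N w\<close> anticommutes with \<open>N z0\<close> and hence exchanges its
  eigenspaces.\<close>

lemma N_W_Ep: "w \<in> W \<Longrightarrow> u \<in> Ep \<Longrightarrow> N w u \<in> Em"
  using clifford[of w u] N_V3[of w u] W_V1[of w] by (simp add: Ep_def Em_def)

lemma N_W_Em: "w \<in> W \<Longrightarrow> v \<in> Em \<Longrightarrow> N w v \<in> Ep"
  using clifford[of w v] N_V3[of w v] W_V1[of w] by (simp add: Ep_def Em_def N_simps)

text \<open>Orthogonality of \<open>u\<close> and \<open>v\<close> removes both the \<open>e\<close>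
  component and the \<open>z0\<close> component.\<close>

lemma N_Ep_Em:
  assumes "u \<in> Ep" "v \<in> Em"
  shows "N u v \<in> W"
proof -
  have "M u v \<in> V1"
    using M_V3_V3[of u v] Ep_V3 Em_V3 Ep_Em assms by simp
  moreover have "N u v \<bullet> z0 = 0"
    using N_inv[of u z0 v] N_comm[of u z0] Ep_Em[OF assms] assms(1) by (simp add: Ep_def)
  ultimately show ?thesis using V1 by (simp add: W_def N_def subspace_scale)
qed

text \<open>Since \<open>N w\<close> exchanges the eigenspaces, \<open>N w x\<close> is orthogonal
  to \<open>x\<close>, so \<open>z0\<close> is the only direction of \<open>V1\<close> left. The
  coefficients are the eigenvalue 1/2 of \<open>M e\<close> and the ratio \<open>sqrt 3 / 2\<close>
  of \<open>M\<close> to \<open>N\<close>.\<close>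

lemma N_square_Ep_Em:
  assumes "u \<in> Ep" "v \<in> Em"
  shows "M u u = (u \<bullet> u) *\<^sub>R ((1 / 2) *\<^sub>R e + (sqrt 3 / 2) *\<^sub>R z0)"
    "M v v = (v \<bullet> v) *\<^sub>R ((1 / 2) *\<^sub>R e - (sqrt 3 / 2) *\<^sub>R z0)"
proof -
  have gen: "M x x = (x \<bullet> x) *\<^sub>R ((1 / 2) *\<^sub>R e + (s * sqrt 3 / 2) *\<^sub>R z0)"
    if x: "x \<in> V3" "N z0 x = s *\<^sub>R x" and W: "\<And>w. w \<in> W \<Longrightarrow> N w x \<bullet> x = 0" for x s
  proof (rule eqI)
    show "M x x \<bullet> e = ((x \<bullet> x) *\<^sub>R ((1 / 2) *\<^sub>R e + (s * sqrt 3 / 2) *\<^sub>R z0)) \<bullet> e"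
      using inv[of x x e] x z0 by (simp add: inner_add_left orth)
    show "M x x \<bullet> \<zeta> = ((x \<bullet> x) *\<^sub>R ((1 / 2) *\<^sub>R e + (s * sqrt 3 / 2) *\<^sub>R z0)) \<bullet> \<zeta>" if "\<zeta> \<in> V3" for \<zeta>
      using symmetric_algebra_zero_on[OF M V3 cube_zero(2) x(1) x(1) that] z0 that
      by (simp add: inner_add_left orth)
    show "M x x \<bullet> \<xi> = ((x \<bullet> x) *\<^sub>R ((1 / 2) *\<^sub>R e + (s * sqrt 3 / 2) *\<^sub>R z0)) \<bullet> \<xi>" if "\<xi> \<in> V1" for \<xi>
    proof -
      define w where "w = \<xi> - (\<xi> \<bullet> z0) *\<^sub>R z0"
      have "w \<in> W" using that V1 z0(1)
        by (simp add: w_def W_def subspace_diff subspace_scale inner_diff_left)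
      have "N x x \<bullet> \<xi> = N \<xi> x \<bullet> x" using N_inv[of x \<xi> x] N_comm[of x \<xi>] by simp
      also have "\<dots> = N ((\<xi> \<bullet> z0) *\<^sub>R z0 + w) x \<bullet> x" by (simp add: w_def)
      also have "\<dots> = (\<xi> \<bullet> z0) * s * (x \<bullet> x)"
        using W[OF \<open>w \<in> W\<close>] x by (simp add: N_simps inner_add_left)
      finally show ?thesis
        using that by (simp add: M_N inner_add_left orth inner_commute[of \<xi>])
    qed
  qed
  show "M u u = (u \<bullet> u) *\<^sub>R ((1 / 2) *\<^sub>R e + (sqrt 3 / 2) *\<^sub>R z0)"
    using gen[of u 1] assms(1) Ep_Em[OF assms(1) N_W_Ep[OF _ assms(1)]]
    by (simp add: Ep_def inner_commute)
  show "M v v = (v \<bullet> v) *\<^sub>R ((1 / 2) *\<^sub>R e - (sqrt 3 / 2) *\<^sub>R z0)"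
    using gen[of v "-1"] assms(2) Ep_Em[OF N_W_Em[OF _ assms(2)] assms(2)]
    by (simp add: Em_def)
qed

text \<open>Adding the norm identities for the squares of \<open>u + v\<close> and
  \<open>u - v\<close> removes the terms linear in \<open>C\<close>. For unit \<open>u\<close> and
  \<open>v\<close> the unit vectors \<open>A\<close> and \<open>B\<close> enclose 120 degrees, so
  \<open>A \<bullet> B\<close> is -1/2 and \<open>C\<close> is left with squared norm 3/4, which the
  normalisation of \<open>N\<close> turns into 1.\<close>

lemma norm_N_Ep_Em:
  assumes "u \<in> Ep" "v \<in> Em"
  shows "N u v \<bullet> N u v = (u \<bullet> u) * (v \<bullet> v)"
proof -
  define A B C where "A = M u u" and "B = M v v" and "C = M u v"
  have uv: "u + v \<in> V3" "u - v \<in> V3" using assms V3 Ep_V3 Em_V3 by (auto intro: subspace_add subspace_diff)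
  have [simp]: "u \<bullet> v = 0" "v \<bullet> u = 0" using Ep_Em[OF assms] by (simp_all add: inner_commute)
  have [simp]: "e \<bullet> z0 = 0" "z0 \<bullet> e = 0" using z0 orth by auto
  have "(A + B + 2 *\<^sub>R C) \<bullet> (A + B + 2 *\<^sub>R C) = (u \<bullet> u + v \<bullet> v)\<^sup>2"
    using square_norms(2)[OF zero_mem(1) uv(1)] comm[of v u]
    by (simp add: alg_simps A_def B_def C_def scaleR_2 algebra_simps)
  moreover have "(A + B - 2 *\<^sub>R C) \<bullet> (A + B - 2 *\<^sub>R C) = (u \<bullet> u + v \<bullet> v)\<^sup>2"
    using square_norms(2)[OF zero_mem(1) uv(2)] comm[of v u]
    by (simp add: alg_simps A_def B_def C_def scaleR_2 algebra_simps)
  moreover have "A \<bullet> A = (u \<bullet> u)\<^sup>2" "B \<bullet> B = (v \<bullet> v)\<^sup>2" "A \<bullet> B = - (u \<bullet> u) * (v \<bullet> v) / 2"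
    unfolding A_def B_def N_square_Ep_Em[OF assms]
    by (simp_all add: alg_simps power2_eq_square algebra_simps)
  ultimately have "4 * (C \<bullet> C) = 3 * (u \<bullet> u) * (v \<bullet> v)"
    by (simp add: alg_simps inner_commute power2_eq_square algebra_simps)
  then show ?thesis by (simp add: N_def C_def)
qed

lemma norm_mult_iff: "norm x = norm y * norm z \<longleftrightarrow> x \<bullet> x = (y \<bullet> y) * (z \<bullet> z)" for x y z :: 'a
proof -
  have "norm x = norm y * norm z \<longleftrightarrow> (norm x)\<^sup>2 = (norm y * norm z)\<^sup>2"
    by (simp add: power2_eq_iff_nonneg)
  then show ?thesis by (simp add: power_mult_distrib power2_norm_eq_inner)
qed

lemma triality:
  assumes "a0 \<in> W" "norm a0 = 1" "b0 \<in> Ep" "norm b0 = 1"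
  shows "triality N W Ep Em a0 b0"
  by unfold_locales
    (use assms N in \<open>simp_all add: subspaces N_W_Ep N_W_Em N_Ep_Em norm_mult_iff norm_N norm_N_Ep_Em
      W_V1 Ep_V3 Em_V3\<close>)

lemma decompose_V1:
  assumes "\<xi> \<in> V1" obtains s w where "w \<in> W" "\<xi> = s *\<^sub>R z0 + w"
proof
  show "\<xi> - (\<xi> \<bullet> z0) *\<^sub>R z0 \<in> W"
    using assms z0(1) V1 by (simp add: W_def subspace_diff subspace_scale inner_diff_left)
  show "\<xi> = (\<xi> \<bullet> z0) *\<^sub>R z0 + (\<xi> - (\<xi> \<bullet> z0) *\<^sub>R z0)" by simp
qed

lemma decompose_V3:
  assumes "\<zeta> \<in> V3" obtains u v where "u \<in> Ep" "v \<in> Em" "\<zeta> = u + v"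
proof
  have NN: "N z0 (N z0 \<zeta>) = \<zeta>" using N_N[OF z0(1) assms] by simp
  show "(1 / 2) *\<^sub>R (\<zeta> + N z0 \<zeta>) \<in> Ep" "(1 / 2) *\<^sub>R (\<zeta> - N z0 \<zeta>) \<in> Em"
    using assms V3 N_V3[OF z0(1) assms]
    by (simp_all add: Ep_def Em_def subspace_scale subspace_add subspace_diff N_simps NN algebra_simps)
  show "\<zeta> = (1 / 2) *\<^sub>R (\<zeta> + N z0 \<zeta>) + (1 / 2) *\<^sub>R (\<zeta> - N z0 \<zeta>)"
    by (simp add: algebra_simps flip: scaleR_add_left)
qed

text \<open>\<open>x1\<close> runs along \<open>e\<close>, \<open>x2\<close> along
  \<open>z0\<close>, and \<open>z3\<close>, \<open>z1\<close>, \<open>z2\<close> through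
  \<open>W\<close>, \<open>Ep\<close>, \<open>Em\<close>. The eigenvalues of \<open>N z0\<close>
  produce the difference of squares beside \<open>x2\<close>; the mixed term occurs twice by
  symmetry, whence \<open>3 * sqrt 3\<close> against \<open>3 * sqrt 3 / 2\<close>.\<close>

lemma cartan_parametrization:
  fixes \<alpha> \<beta> \<gamma> :: "'f::euclidean_space \<Rightarrow> 'a"
  assumes iso: "isometry_onto \<alpha> W" "isometry_onto \<beta> Ep" "isometry_onto \<gamma> Em"
    and re: "\<And>z1 z2 z3. N (\<alpha> z3) (\<beta> z1) \<bullet> \<gamma> z2 = re (m (m z1 z2) z3)"
  shows "\<exists>S. isometry_onto S UNIV \<and> (\<forall>v. M (S v) (S v) \<bullet> S v = cartan_poly m re v)"
proof -
  define S where "S = (\<lambda>(x1, x2, z1, z2, z3). x1 *\<^sub>R e + (x2 *\<^sub>R z0 + \<alpha> z3) + (\<beta> z1 + \<gamma> z2))"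
  have lin: "linear \<alpha>" "linear \<beta>" "linear \<gamma>" and ran: "range \<alpha> = W" "range \<beta> = Ep" "range \<gamma> = Em"
    using iso by (auto simp: isometry_onto_def)
  have mem: "\<alpha> z \<in> W" "\<beta> z \<in> Ep" "\<gamma> z \<in> Em" for z using ran by auto
  note inn = isometry_onto_inner[OF iso(1)] isometry_onto_inner[OF iso(2)] isometry_onto_inner[OF iso(3)]
  have o: "\<alpha> z \<bullet> z0 = 0" "z0 \<bullet> \<alpha> z = 0" "\<beta> z \<bullet> \<gamma> z' = 0" "\<gamma> z' \<bullet> \<beta> z = 0" for z z'
    using mem(1)[of z] Ep_Em[OF mem(2,3)] by (auto simp: W_def inner_commute)
  have sub: "x2 *\<^sub>R z0 + \<alpha> z3 \<in> V1" "\<beta> z1 + \<gamma> z2 \<in> V3" for x2 z1 z2 z3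
    using mem W_V1 Ep_V3 Em_V3 z0 V1 V3 by (auto intro!: subspace_add subspace_scale)
  have n1: "(x2 *\<^sub>R z0 + \<alpha> z3) \<bullet> (x2 *\<^sub>R z0 + \<alpha> z3) = x2\<^sup>2 + (norm z3)\<^sup>2" for x2 z3
    by (simp add: inner_add_left inner_add_right o inn power2_norm_eq_inner power2_eq_square[of x2])
  have n3: "(\<beta> z1 + \<gamma> z2) \<bullet> (\<beta> z1 + \<gamma> z2) = (norm z1)\<^sup>2 + (norm z2)\<^sup>2" for z1 z2
    by (simp add: inner_add_left inner_add_right o inn power2_norm_eq_inner)
  have "linear S"
    by (rule linearI)
      (auto simp: S_def linear_add[OF lin(1)] linear_add[OF lin(2)] linear_add[OF lin(3)]
        linear_scale[OF lin(1)] linear_scale[OF lin(2)] linear_scale[OF lin(3)] algebra_simps)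
  moreover have "norm (S v) = norm v" for v
  proof (cases v)
    case (fields x1 x2 z1 z2 z3)
    have "S v \<bullet> S v = x1\<^sup>2 + (x2 *\<^sub>R z0 + \<alpha> z3) \<bullet> (x2 *\<^sub>R z0 + \<alpha> z3) + (\<beta> z1 + \<gamma> z2) \<bullet> (\<beta> z1 + \<gamma> z2)"
      unfolding fields S_def prod.case by (rule inner_decompose[OF sub])
    then have "(norm (S v))\<^sup>2 = (norm v)\<^sup>2"
      unfolding n1 n3 by (simp add: fields power2_norm_eq_inner norm_Pair)
    then show ?thesis by (simp add: power2_eq_iff_nonneg)
  qed
  moreover have "x \<in> range S" for x
  proof -
    obtain t \<xi> \<zeta> where x: "x = t *\<^sub>R e + \<xi> + \<zeta>" "\<xi> \<in> V1" "\<zeta> \<in> V3" by (rule decompose)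
    obtain s w where w: "w \<in> W" "\<xi> = s *\<^sub>R z0 + w" using decompose_V1[OF x(2)] .
    obtain u v where uv: "u \<in> Ep" "v \<in> Em" "\<zeta> = u + v" using decompose_V3[OF x(3)] .
    obtain z1 z2 z3 where "w = \<alpha> z3" "u = \<beta> z1" "v = \<gamma> z2"
      using w(1) uv(1,2) unfolding ran[symmetric] by blast
    then have "x = S (t, s, z1, z2, z3)" by (simp add: x w uv S_def)
    then show ?thesis by blast
  qed
  ultimately have "isometry_onto S UNIV" unfolding isometry_onto_def by auto
  moreover have "M (S v) (S v) \<bullet> S v = cartan_poly m re v" for v
  proof (cases v)
    case (fields x1 x2 z1 z2 z3)
    let ?\<xi> = "x2 *\<^sub>R z0 + \<alpha> z3" and ?\<zeta> = "\<beta> z1 + \<gamma> z2"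
    have N1: "N z0 (\<beta> z1) = \<beta> z1" "N z0 (\<gamma> z2) = - \<gamma> z2" using mem by (auto simp: Ep_def Em_def)
    have N2: "N (\<alpha> z3) (\<beta> z1) \<bullet> \<beta> z1 = 0" "N (\<alpha> z3) (\<gamma> z2) \<bullet> \<gamma> z2 = 0"
      using Ep_Em[OF mem(2) N_W_Ep[OF mem(1,2)]] Ep_Em[OF N_W_Em[OF mem(1,3)] mem(3)]
      by (simp_all add: inner_commute)
    have N3: "N (\<alpha> z3) (\<gamma> z2) \<bullet> \<beta> z1 = N (\<alpha> z3) (\<beta> z1) \<bullet> \<gamma> z2" by (rule N_inv)
    have NN: "N ?\<xi> ?\<zeta> \<bullet> ?\<zeta> = x2 * ((norm z1)\<^sup>2 - (norm z2)\<^sup>2) + 2 * re (m (m z1 z2) z3)"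
      by (simp add: N_simps inner_add_left inner_add_right inner_diff_left N1 N2 N3 re o inn power2_norm_eq_inner algebra_simps)
    have MM: "M (S v) (S v) \<bullet> S v = x1 ^ 3 - 3 * x1 * (x2\<^sup>2 + (norm z3)\<^sup>2)
       + 3 / 2 * x1 * ((norm z1)\<^sup>2 + (norm z2)\<^sup>2) + 3 * (sqrt 3 / 2 * (N ?\<xi> ?\<zeta> \<bullet> ?\<zeta>))"
      unfolding fields S_def prod.case cubic_value[OF sub] n1 n3 M_N[of ?\<xi> ?\<zeta> ?\<zeta>] ..
    show ?thesis unfolding MM NN by (simp add: fields field_simps)
  qed
  ultimately show ?thesis by blast
qed

text \<open>\<open>V3\<close> and \<open>W\<close> both vanish, which leaves
  \<open>t^3 - 3 * t * s^2\<close>. The cubed coordinate of \<open>theta0\<close> is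
  \<open>x2\<close>, hence the swapped order in \<open>S\<close>.\<close>

lemma theta0_parametrization:
  assumes "dim V1 = 1"
  shows "\<exists>S. isometry_onto S UNIV \<and> (\<forall>v. M (S v) (S v) \<bullet> S v = theta0 v)"
proof -
  have V3_0: "V3 = {0}"
    using dim_V3 assms zero_mem(2) dim_eq_0[of V3] by auto
  have W_0: "w = 0" if "w \<in> W" for w
  proof (rule ccontr)
    assume "w \<noteq> 0"
    have "pairwise orthogonal {z0, w}" using that by (auto simp: W_def pairwise_def orthogonal_def inner_commute)
    moreover have "0 \<notin> {z0, w}" using z0 \<open>w \<noteq> 0\<close> by auto
    ultimately have "independent {z0, w}" by (rule pairwise_orthogonal_independent)
    moreover have "{z0, w} \<subseteq> V1" using z0 that W_V1 by simp
    ultimately have "card {z0, w} \<le> dim V1" by (intro independent_card_le_dim)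
    moreover have "z0 \<noteq> w" using that z0 by (auto simp: W_def)
    ultimately show False using assms by simp
  qed
  define S where "S = (\<lambda>(x1, x2). x2 *\<^sub>R e + x1 *\<^sub>R z0 :: 'a)"
  have [simp]: "e \<bullet> z0 = 0" "z0 \<bullet> e = 0" using z0 orth by auto
  have "linear S" by (rule linearI) (auto simp: S_def algebra_simps)
  moreover have "norm (S v) = norm v" for v
    by (cases v) (simp add: S_def norm_eq_sqrt_inner alg_simps power2_eq_square)
  moreover have "x \<in> range S" for x
  proof -
    obtain t \<xi> \<zeta> where x: "x = t *\<^sub>R e + \<xi> + \<zeta>" "\<xi> \<in> V1" "\<zeta> \<in> V3" by (rule decompose)
    obtain s w where w: "w \<in> W" "\<xi> = s *\<^sub>R z0 + w" using decompose_V1[OF x(2)] .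
    have "x = S (s, t)" using x(3) W_0[OF w(1)] by (simp add: S_def x(1) w(2) V3_0)
    then show ?thesis by blast
  qed
  ultimately have "isometry_onto S UNIV" unfolding isometry_onto_def by auto
  moreover have "M (S v) (S v) \<bullet> S v = theta0 v" for v
  proof (cases v)
    case (Pair x1 x2)
    have "x1 *\<^sub>R z0 \<in> V1" using z0 V1 by (simp add: subspace_scale)
    from cubic_value[OF this zero_mem(2), of x2] show ?thesis
      by (simp add: Pair S_def power2_eq_square symmetric_algebra_simps[OF M])
  qed
  ultimately show ?thesis by blast
qed

lemma cartan_cases:
  assumes "W \<noteq> {0}"
  shows "(\<exists>S. isometry_onto S UNIV \<and> (\<forall>v. M (S v) (S v) \<bullet> S v = theta1 v)) \<or>
    (\<exists>S. isometry_onto S UNIV \<and> (\<forall>v. M (S v) (S v) \<bullet> S v = theta2 v)) \<or>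
    (\<exists>S. isometry_onto S UNIV \<and> (\<forall>v. M (S v) (S v) \<bullet> S v = theta4 v)) \<or>
    (\<exists>S. isometry_onto S UNIV \<and> (\<forall>v. M (S v) (S v) \<bullet> S v = theta8 v))"
proof -
  have unit: "\<exists>x0\<in>S. norm x0 = 1" if S: "subspace S" "S \<noteq> {0}" for S :: "'a set"
  proof -
    obtain x where "x \<in> S" "x \<noteq> 0" using S subspace_0[of S] by blast
    then show ?thesis using S(1) by (intro bexI[of _ "(1 / norm x) *\<^sub>R x"]) (auto intro: subspace_scale)
  qed
  obtain a0 where a0: "a0 \<in> W" "norm a0 = 1" using unit[OF subspaces(1) assms] by blast
  \<comment> \<open>\<open>z0\<close> and \<open>a0\<close> are orthogonal, so \<open>V1\<close> has
    dimension at least 2, while \<open>V3 = {0}\<close> would leave it dimension 1.\<close>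
  have "V3 \<noteq> {0}"
  proof
    assume "V3 = {0}"
    then have "dim V1 = 1" using dim_V3 by simp
    moreover have "pairwise orthogonal {z0, a0}" using a0 by (auto simp: W_def pairwise_def orthogonal_def inner_commute)
    moreover have "0 \<notin> {z0, a0}" using z0 a0 by auto
    ultimately have "independent {z0, a0}" by (intro pairwise_orthogonal_independent)
    moreover have "{z0, a0} \<subseteq> V1" using z0 a0 W_V1 by simp
    ultimately have "card {z0, a0} \<le> dim V1" by (intro independent_card_le_dim)
    moreover have "z0 \<noteq> a0" using a0 z0 by (auto simp: W_def)
    ultimately show False using \<open>dim V1 = 1\<close> by simp
  qed
  then obtain \<zeta> where \<zeta>: "\<zeta> \<in> V3" "\<zeta> \<noteq> 0" using zero_mem(2) by blast
  \<comment> \<open>\<open>N a0\<close> maps \<open>Em\<close> isometrically into \<open>Ep\<close>,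
    so an empty \<open>+1\<close> eigenspace would force all of \<open>V3\<close> to vanish.\<close>
  have "Ep \<noteq> {0}"
  proof
    assume Ep: "Ep = {0}"
    obtain u v where uv: "u \<in> Ep" "v \<in> Em" "\<zeta> = u + v" using decompose_V3[OF \<zeta>(1)] .
    have "N a0 v = 0" using N_W_Em[OF a0(1) uv(2)] Ep by simp
    then have "(a0 \<bullet> a0) * (v \<bullet> v) = 0"
      using norm_N[OF W_V1[OF a0(1)] Em_V3[OF uv(2)]] by simp
    then show False using a0 uv \<zeta>(2) Ep by auto
  qed
  then obtain b0 where b0: "b0 \<in> Ep" "norm b0 = 1" using unit[OF subspaces(2)] by blast
  interpret triality N W Ep Em a0 b0 by (rule triality[OF a0 b0])
  have param: "\<exists>S. isometry_onto S UNIV \<and> (\<forall>v. M (S v) (S v) \<bullet> S v = cartan_poly m re v)"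
    if E: "embedding m k \<Phi>" "range \<Phi> = Em" "\<And>z1 z2 z3. m z3 z1 \<bullet> k z2 = re (m (m z1 z2) z3)"
    for m :: "'f::euclidean_space \<Rightarrow> 'f \<Rightarrow> 'f" and k re \<Phi>
  proof -
    obtain \<alpha> \<beta> \<gamma> :: "'f \<Rightarrow> 'a" where "isometry_onto \<alpha> W" "isometry_onto \<beta> Ep" "isometry_onto \<gamma> Em"
      "\<forall>z1 z2 z3. N (\<alpha> z3) (\<beta> z1) \<bullet> \<gamma> z2 = re (m (m z1 z2) z3)"
      using parametrization[OF E] by blast
    then show ?thesis by (intro cartan_parametrization) auto
  qed
  show ?thesis
    using hurwitz
  proof (elim disjE exE conjE)
    fix \<Phi> :: "real \<Rightarrow> 'a" assume E: "embedding (*) (\<lambda>x. x) \<Phi>" "range \<Phi> = Em"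
    have "\<exists>S. isometry_onto S UNIV \<and> (\<forall>v. M (S v) (S v) \<bullet> S v = theta1 v)"
      unfolding theta1_def by (rule param[OF E]) (rule inner_real_triple)
    then show ?thesis by simp
  next
    fix \<Phi> :: "complex \<Rightarrow> 'a" assume E: "embedding (*) cnj \<Phi>" "range \<Phi> = Em"
    have "\<exists>S. isometry_onto S UNIV \<and> (\<forall>v. M (S v) (S v) \<bullet> S v = theta2 v)"
      unfolding theta2_def by (rule param[OF E]) (rule inner_cnj_triple)
    then show ?thesis by simp
  next
    fix \<Phi> :: "quat \<Rightarrow> 'a" assume E: "embedding quat_mult quat_cnj \<Phi>" "range \<Phi> = Em"
    have "\<exists>S. isometry_onto S UNIV \<and> (\<forall>v. M (S v) (S v) \<bullet> S v = theta4 v)"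
      unfolding theta4_def by (rule param[OF E]) (rule inner_quat_cnj_triple)
    then show ?thesis by simp
  next
    fix \<Phi> :: "octo \<Rightarrow> 'a" assume E: "embedding octo_mult octo_cnj \<Phi>" "range \<Phi> = Em"
    have "\<exists>S. isometry_onto S UNIV \<and> (\<forall>v. M (S v) (S v) \<bullet> S v = theta8 v)"
      unfolding theta8_def by (rule param[OF E]) (rule inner_octo_cnj_triple)
    then show ?thesis by simp
  qed
qed

end

section \<open>Classification\<close>

lemma congruent_forms_DIM:
  fixes f :: "'a::euclidean_space \<Rightarrow> real" and g :: "'b::euclidean_space \<Rightarrow> real"
  assumes "congruent_forms f g"
  shows "DIM('a) = DIM('b)"
proof -
  obtain U :: "'a \<Rightarrow> 'b" where U: "linear U" "\<And>v w. U v \<bullet> U w = v \<bullet> w" "surj U"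
    using assms unfolding congruent_forms_def by blast
  have "x = 0" if "U x = 0" for x using U(2)[of x x] that by simp
  then have "inj U" using U(1) by (simp add: linear_injective_0)
  then have "dim (range U) = dim (UNIV :: 'a set)" by (intro dim_image_eq U(1)) (simp add: span_UNIV)
  then show ?thesis using U(3) by simp
qed

lemma normal_form_classification:
  fixes f :: "real ^ 'n \<Rightarrow> real"
  assumes rad: "radial_eigencubic f" and nf: "normal_form f e V1 V2 V3" and V2: "dim V2 = 0"
  shows "congruent_forms f theta1 \<or> congruent_forms f theta2 \<or> congruent_forms f theta4 \<or>
      congruent_forms f theta8 \<or> congruent_forms f theta0"
    "CARD('n) = 1 + dim V1 + dim V3" "dim V3 + 2 = 2 * dim V1"
proof -
  obtain lam where lam: "lam \<noteq> 0" "\<And>x. L_op f x = lam * (norm x)\<^sup>2 * f x" and cub: "cubic_form f"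
    using rad unfolding radial_eigencubic_def by blast
  obtain M0 where M0: "symmetric_algebra M0" and f': "\<forall>x. f x = M0 x x \<bullet> x"
    by (rule cubic_form_algebra[OF cub])
  note f = f'[rule_format]
  have "V2 = {0}"
    using nf V2 dim_eq_0[of V2] subspace_0[of V2]
    by (auto simp: normal_form_def orthogonal_decomposition_def)
  then have dec: "orthogonal_decomposition e V1 {0} V3" using nf by (simp add: normal_form_def)
  obtain c \<psi>111 \<psi>102 \<psi>012 \<psi>030 where c: "c \<noteq> 0"
    and "multihomogeneous 1 1 1 V1 {0} V3 \<psi>111" "multihomogeneous 1 0 2 V1 {0} V3 \<psi>102"
      "multihomogeneous 0 1 2 V1 {0} V3 \<psi>012" "multihomogeneous 0 3 0 V1 {0} V3 \<psi>030"
    and cf: "\<forall>t. \<forall>\<xi>\<in>V1. \<forall>\<eta>\<in>{0}. \<forall>\<zeta>\<in>V3.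
           c * f (t *\<^sub>R e + \<xi> + \<eta> + \<zeta>) =
             t ^ 3 - 3 / 2 * t * (2 * (norm \<xi>)\<^sup>2 + (norm \<eta>)\<^sup>2 - (norm \<zeta>)\<^sup>2)
             + \<psi>111 (\<xi>, \<eta>, \<zeta>) + \<psi>102 (\<xi>, \<eta>, \<zeta>) + \<psi>012 (\<xi>, \<eta>, \<zeta>) + \<psi>030 (\<xi>, \<eta>, \<zeta>)"
    using nf unfolding normal_form_def \<open>V2 = {0}\<close> by blast
  then have mh: "\<And>\<xi> \<zeta> r s t. \<xi> \<in> V1 \<Longrightarrow> \<zeta> \<in> V3 \<Longrightarrow> \<psi>111 (r *\<^sub>R \<xi>, 0, t *\<^sub>R \<zeta>) = r * s * t * \<psi>111 (\<xi>, 0, \<zeta>)"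
    "\<And>\<xi> \<zeta> r t. \<xi> \<in> V1 \<Longrightarrow> \<zeta> \<in> V3 \<Longrightarrow> \<psi>102 (r *\<^sub>R \<xi>, 0, t *\<^sub>R \<zeta>) = r * t\<^sup>2 * \<psi>102 (\<xi>, 0, \<zeta>)"
    "\<And>\<xi> \<zeta> r s t. \<xi> \<in> V1 \<Longrightarrow> \<zeta> \<in> V3 \<Longrightarrow> \<psi>012 (r *\<^sub>R \<xi>, 0, t *\<^sub>R \<zeta>) = s * t\<^sup>2 * \<psi>012 (\<xi>, 0, \<zeta>)"
    "\<And>\<xi> \<zeta> r s t. \<xi> \<in> V1 \<Longrightarrow> \<zeta> \<in> V3 \<Longrightarrow> \<psi>030 (r *\<^sub>R \<xi>, 0, t *\<^sub>R \<zeta>) = s ^ 3 * \<psi>030 (\<xi>, 0, \<zeta>)"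
    unfolding multihomogeneous_def by simp_all
  \<comment> \<open>At \<eta> = 0 the scaling factor of \<eta> is arbitrary; choosing 0 kills every
    term of positive degree in \<eta>.\<close>
  have zero: "\<psi>111 (\<xi>, 0, \<zeta>) = 0" "\<psi>012 (\<xi>, 0, \<zeta>) = 0" "\<psi>030 (\<xi>, 0, \<zeta>) = 0"
    if "\<xi> \<in> V1" "\<zeta> \<in> V3" for \<xi> \<zeta>
    using mh(1)[OF that, of 1 1 0] mh(3)[OF that, of 1 1 0] mh(4)[OF that, of 1 1 0] by simp_all
  define M where "M x y = c *\<^sub>R M0 x y" for x y
  have M: "symmetric_algebra M"
    using M0 unfolding symmetric_algebra_def M_def bilinear_def linear_iff
    by (simp add: scaleR_add_right mult.commute)
  have Mf: "M x x \<bullet> x = c * f x" for x by (simp add: M_def f)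
  \<comment> \<open>\<open>M\<close> represents \<open>c * f\<close>. L is cubic in the form while
    the right side is linear, so the eigenvalue acquires the factor
    \<open>c\<^sup>2\<close>.\<close>
  interpret E: eigen_algebra M e V1 V3 "\<lambda>\<xi> \<zeta>. \<psi>102 (\<xi>, 0, \<zeta>)" "c\<^sup>2 * lam"
  proof
    show "M (t *\<^sub>R e + \<xi> + \<zeta>) (t *\<^sub>R e + \<xi> + \<zeta>) \<bullet> (t *\<^sub>R e + \<xi> + \<zeta>)
        = t ^ 3 - 3 * t * (\<xi> \<bullet> \<xi>) + 3 / 2 * t * (\<zeta> \<bullet> \<zeta>) + \<psi>102 (\<xi>, 0, \<zeta>)"
      if "\<xi> \<in> V1" "\<zeta> \<in> V3" for t \<xi> \<zeta>
      using cf that zero[OF that] unfolding Mf by (simp add: power2_norm_eq_inner algebra_simps)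
    show "54 * (M x x \<bullet> M x x) * (\<Sum>b\<in>Basis. M x b \<bullet> b) - 54 * (M x (M x x) \<bullet> M x x)
       = c\<^sup>2 * lam * (x \<bullet> x) * (M x x \<bullet> x)" for x
    proof -
      have "54 * (M x x \<bullet> M x x) * (\<Sum>b\<in>Basis. M x b \<bullet> b) - 54 * (M x (M x x) \<bullet> M x x) = c ^ 3 * L_op f x"
        unfolding L_op_cubic[OF M0 f] M_def
        by (simp add: symmetric_algebra_simps[OF M0] algebra_simps power3_eq_cube flip: sum_distrib_left)
      then show ?thesis
        by (simp add: lam(2) Mf dot_square_norm power2_eq_square power3_eq_cube)
    qed
  qed (use M dec c lam(1) mh(2) in simp_all)
  show "dim V3 + 2 = 2 * dim V1" by (rule E.dim_V3)
  show "CARD('n) = 1 + dim V1 + dim V3" using E.dimension_trace(1) by simp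
  have cong: "congruent_forms f g" if S: "\<exists>S. isometry_onto S UNIV \<and> (\<forall>v. M (S v) (S v) \<bullet> S v = g v)"
    for g :: "'b::euclidean_space \<Rightarrow> real"
  proof -
    obtain S where "isometry_onto S UNIV" "\<forall>v. M (S v) (S v) \<bullet> S v = g v" using S by (elim exE conjE)
    then show ?thesis by (intro congruent_formsI[of S c f g] c) (simp_all flip: Mf)
  qed
  have "dim V1 \<noteq> 0" using E.dim_V3 by linarith
  then have "\<not> V1 \<subseteq> {0}" by simp
  then obtain x where "x \<in> V1" "x \<noteq> 0" by blast
  then have "(1 / norm x) *\<^sub>R x \<in> V1" "norm ((1 / norm x) *\<^sub>R x) = 1"
    using E.V1 by (auto intro: subspace_scale)
  then interpret E: eigen_algebra_unit M e V1 V3 "\<lambda>\<xi> \<zeta>. \<psi>102 (\<xi>, 0, \<zeta>)" "c\<^sup>2 * lam" "(1 / norm x) *\<^sub>R x"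
    by unfold_locales
  show "congruent_forms f theta1 \<or> congruent_forms f theta2 \<or> congruent_forms f theta4 \<or>
      congruent_forms f theta8 \<or> congruent_forms f theta0"
  proof (cases "E.W = {0}")
    case True
    have "V1 \<subseteq> span {(1 / norm x) *\<^sub>R x}"
    proof
      fix \<xi> assume "\<xi> \<in> V1"
      then obtain s w where "w \<in> E.W" "\<xi> = s *\<^sub>R ((1 / norm x) *\<^sub>R x) + w" by (rule E.decompose_V1)
      then show "\<xi> \<in> span {(1 / norm x) *\<^sub>R x}" 
        using True span_scale[OF span_base[of "(1 / norm x) *\<^sub>R x"], of _ s] by simp
    qed
    then have "dim V1 \<le> card {(1 / norm x) *\<^sub>R x}" by (intro dim_le_card) simp_all
    then have "dim V1 \<le> 1" by simp
    with \<open>dim V1 \<noteq> 0\<close> have "dim V1 = 1" by linarith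
    from cong[OF E.theta0_parametrization[OF this]] show ?thesis by simp
  next
    case False
    from E.cartan_cases[OF this] show ?thesis by (elim disjE) (simp_all add: cong)
  qed
qed

text \<open>The decomposition is moved by the inverse isometry. The rescaled \<open>f\<close> at
  \<xi> + \<zeta> plays the part of \<psi>102: it is a polynomial because \<open>f\<close> is one,
  and \<open>hom\<close> supplies its degrees 1 and 2.\<close>

lemma normal_form_pullback:
  fixes f :: "'a::euclidean_space \<Rightarrow> real" and g :: "'b::euclidean_space \<Rightarrow> real"
  assumes cub: "cubic_form f" and cong: "congruent_forms f g"
    and dec: "orthogonal_decomposition e V1 {0} V3"
    and g: "\<And>t \<xi> \<zeta>. \<xi> \<in> V1 \<Longrightarrow> \<zeta> \<in> V3 \<Longrightarrow>
      g (t *\<^sub>R e + \<xi> + \<zeta>) = t ^ 3 - 3 / 2 * t * (2 * (norm \<xi>)\<^sup>2 - (norm \<zeta>)\<^sup>2) + g (\<xi> + \<zeta>)"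
    and hom: "\<And>r s \<xi> \<zeta>. \<xi> \<in> V1 \<Longrightarrow> \<zeta> \<in> V3 \<Longrightarrow> g (r *\<^sub>R \<xi> + s *\<^sub>R \<zeta>) = r * s\<^sup>2 * g (\<xi> + \<zeta>)"
  shows "\<exists>e V1 V2 V3. normal_form f e V1 V2 V3 \<and> dim V2 = 0"
proof -
  obtain U :: "'a \<Rightarrow> 'b" and c where U: "linear U" "\<And>v w. U v \<bullet> U w = v \<bullet> w" "surj U"
    and c: "c \<noteq> 0" and f: "\<And>x. f x = c * g (U x)"
    using cong unfolding congruent_forms_def by blast
  have "x = 0" if "U x = 0" for x using U(2)[of x x] that by simp
  then have inj: "inj U" using U(1) by (simp add: linear_injective_0)
  define T where "T = inv U"
  have UT: "U (T x) = x" for x unfolding T_def using U(3) by (rule surj_f_inv_f)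
  have TU: "T (U x) = x" for x unfolding T_def using inj by (rule inv_f_f)
  have T: "linear T"
  proof (rule linearI)
    show "T (x + y) = T x + T y" for x y
      using TU[of "T x + T y"] by (simp add: linear_add[OF U(1)] UT)
    show "T (r *\<^sub>R x) = r *\<^sub>R T x" for r x
      using TU[of "r *\<^sub>R T x"] by (simp add: linear_scale[OF U(1)] UT)
  qed
  have Tinner: "T x \<bullet> T y = x \<bullet> y" for x y using U(2)[of "T x" "T y"] by (simp add: UT)
  then have Tnorm: "norm (T x) = norm x" for x by (simp add: norm_eq)
  have fT: "1 / c * f (T x) = g x" for x using c by (simp add: f UT)
  note Tsimps = linear_add[OF T] linear_scale[OF T] linear_0[OF T]
  have dec': "orthogonal_decomposition (T e) (T ` V1) {0} (T ` V3)"
    unfolding orthogonal_decomposition_def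
  proof (intro conjI)
    show "norm (T e) = 1" "subspace (T ` V1)" "subspace {0::'a}" "subspace (T ` V3)"
      using dec T by (simp_all add: orthogonal_decomposition_def Tnorm linear_subspace_image)
    show "\<forall>\<xi>\<in>T ` V1. \<forall>\<eta>\<in>{0}. \<forall>\<zeta>\<in>T ` V3.
        orthogonal (T e) \<xi> \<and> orthogonal (T e) \<eta> \<and> orthogonal (T e) \<zeta> \<and>
        orthogonal \<xi> \<eta> \<and> orthogonal \<xi> \<zeta> \<and> orthogonal \<eta> \<zeta>"
      using dec by (auto simp: orthogonal_decomposition_def orthogonal_def Tinner)
    show "\<forall>x. \<exists>t. \<exists>\<xi>\<in>T ` V1. \<exists>\<eta>\<in>{0}. \<exists>\<zeta>\<in>T ` V3. x = t *\<^sub>R T e + \<xi> + \<eta> + \<zeta>"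
    proof
      fix x
      obtain t \<xi> \<zeta> where "U x = t *\<^sub>R e + \<xi> + \<zeta>" "\<xi> \<in> V1" "\<zeta> \<in> V3"
        using dec[unfolded orthogonal_decomposition_def, THEN conjunct2, THEN conjunct2,
            THEN conjunct2, THEN conjunct2, THEN conjunct2, rule_format, of "U x"] by auto
      then have "x = t *\<^sub>R T e + T \<xi> + 0 + T \<zeta>" using TU[of x] by (simp add: Tsimps)
      then show "\<exists>t. \<exists>\<xi>\<in>T ` V1. \<exists>\<eta>\<in>{0}. \<exists>\<zeta>\<in>T ` V3. x = t *\<^sub>R T e + \<xi> + \<eta> + \<zeta>"
        using \<open>\<xi> \<in> V1\<close> \<open>\<zeta> \<in> V3\<close> by blast
    qed
  qed
  have "polynomial_function (\<lambda>p :: 'a \<times> 'a \<times> 'a. fst p + snd (snd p))"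
    by (intro polynomial_function_bounded_linear bounded_linear_intros)
  then have "real_polynomial_function (f \<circ> (\<lambda>p :: 'a \<times> 'a \<times> 'a. fst p + snd (snd p)))"
    using cub by (intro real_polynomial_function_compose) (auto simp: cubic_form_def)
  then have poly: "real_polynomial_function (\<lambda>p :: 'a \<times> 'a \<times> 'a. 1 / c * f (fst p + snd (snd p)))" 
    by (intro real_polynomial_function.intros(2,4)) (simp add: o_def)
  have "normal_form f (T e) (T ` V1) {0} (T ` V3)"
    unfolding normal_form_def
  proof (intro conjI dec' exI)
    show "1 / c \<noteq> 0" using c by simp
    show "multihomogeneous 1 1 1 (T ` V1) {0} (T ` V3) (\<lambda>p. 0)"
      "multihomogeneous 0 1 2 (T ` V1) {0} (T ` V3) (\<lambda>p. 0)"
      "multihomogeneous 0 3 0 (T ` V1) {0} (T ` V3) (\<lambda>p. 0)"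
      by (simp_all add: multihomogeneous_def real_polynomial_function.intros(2))
    show "multihomogeneous 1 0 2 (T ` V1) {0} (T ` V3) (\<lambda>p. 1 / c * f (fst p + snd (snd p)))"
      unfolding multihomogeneous_def
    proof (intro conjI poly ballI allI)
      fix \<xi> \<eta> \<zeta> r s t assume "\<xi> \<in> T ` V1" "\<zeta> \<in> T ` V3"
      then obtain \<xi>' \<zeta>' where *: "\<xi> = T \<xi>'" "\<zeta> = T \<zeta>'" "\<xi>' \<in> V1" "\<zeta>' \<in> V3" by blast
      have "1 / c * f (r *\<^sub>R \<xi> + t *\<^sub>R \<zeta>) = r * t\<^sup>2 * (1 / c * f (\<xi> + \<zeta>))"
        using hom[OF *(3,4), of r t] unfolding *(1,2) by (simp only: fT flip: Tsimps)
      then show "1 / c * f (fst (r *\<^sub>R \<xi>, s *\<^sub>R \<eta>, t *\<^sub>R \<zeta>) + snd (snd (r *\<^sub>R \<xi>, s *\<^sub>R \<eta>, t *\<^sub>R \<zeta>)))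
        = r ^ 1 * s ^ 0 * t\<^sup>2 * (1 / c * f (fst (\<xi>, \<eta>, \<zeta>) + snd (snd (\<xi>, \<eta>, \<zeta>))))" by simp
    qed
    show "\<forall>t. \<forall>\<xi>\<in>T ` V1. \<forall>\<eta>\<in>{0}. \<forall>\<zeta>\<in>T ` V3. 1 / c * f (t *\<^sub>R T e + \<xi> + \<eta> + \<zeta>) =
        t ^ 3 - 3 / 2 * t * (2 * (norm \<xi>)\<^sup>2 + (norm \<eta>)\<^sup>2 - (norm \<zeta>)\<^sup>2) + 0
        + 1 / c * f (fst (\<xi>, \<eta>, \<zeta>) + snd (snd (\<xi>, \<eta>, \<zeta>))) + 0 + 0"
    proof (intro allI ballI)
      fix t \<xi> \<eta> \<zeta> assume "\<xi> \<in> T ` V1" "\<eta> \<in> {0 :: 'a}" "\<zeta> \<in> T ` V3"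
      then obtain \<xi>' \<zeta>' where *: "\<xi> = T \<xi>'" "\<zeta> = T \<zeta>'" "\<eta> = 0" "\<xi>' \<in> V1" "\<zeta>' \<in> V3" by blast
      have "1 / c * f (T (t *\<^sub>R e + \<xi>' + \<zeta>')) = t ^ 3 - 3 / 2 * t * (2 * (norm \<xi>')\<^sup>2 - (norm \<zeta>')\<^sup>2)
          + 1 / c * f (T (\<xi>' + \<zeta>'))"
        using g[OF *(4,5), of t] by (simp only: fT)
      then show "1 / c * f (t *\<^sub>R T e + \<xi> + \<eta> + \<zeta>) =
        t ^ 3 - 3 / 2 * t * (2 * (norm \<xi>)\<^sup>2 + (norm \<eta>)\<^sup>2 - (norm \<zeta>)\<^sup>2) + 0
        + 1 / c * f (fst (\<xi>, \<eta>, \<zeta>) + snd (snd (\<xi>, \<eta>, \<zeta>))) + 0 + 0"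
        by (simp add: *(1,2,3) Tsimps Tnorm)
    qed
  qed
  moreover have "dim {0::'a} = 0" by simp
  ultimately show ?thesis by (intro exI conjI)
qed

text \<open>The multiples of \<open>x1\<close> in \<open>cartan_poly\<close> dictate the splitting:
  -3 on \<open>x2\<close> and \<open>z3\<close>, 3/2 on \<open>z1\<close> and \<open>z2\<close>.
  What remains is linear in the first pair and quadratic in the second.\<close>

lemma normal_form_cartan:
  fixes f :: "'a::euclidean_space \<Rightarrow> real" and m :: "'f::euclidean_space \<Rightarrow> 'f \<Rightarrow> 'f"
  assumes cub: "cubic_form f" and cong: "congruent_forms f (cartan_poly m re)"
    and ml: "\<And>r x y. m (r *\<^sub>R x) y = r *\<^sub>R m x y" and mr: "\<And>r x y. m x (r *\<^sub>R y) = r *\<^sub>R m x y"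
    and re: "\<And>r x. re (r *\<^sub>R x) = r * re x"
  shows "\<exists>e V1 V2 V3. normal_form f e V1 V2 V3 \<and> dim V2 = 0"
proof -
  define e :: "real \<times> real \<times> 'f \<times> 'f \<times> 'f" where "e = (1, 0, 0, 0, 0)"
  define V1 V3 :: "(real \<times> real \<times> 'f \<times> 'f \<times> 'f) set"
    where "V1 = {(x1, x2, z1, z2, z3). x1 = 0 \<and> z1 = 0 \<and> z2 = 0}"
      and "V3 = {(x1, x2, z1, z2, z3). x1 = 0 \<and> x2 = 0 \<and> z3 = 0}"
  show ?thesis
  proof (rule normal_form_pullback[OF cub cong])
    show "orthogonal_decomposition e V1 {0} V3"
      unfolding orthogonal_decomposition_def
    proof (intro conjI allI)
      show "\<exists>t. \<exists>\<xi>\<in>V1. \<exists>\<eta>\<in>{0}. \<exists>\<zeta>\<in>V3. x = t *\<^sub>R e + \<xi> + \<eta> + \<zeta>" for x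
      proof (cases x)
        case (fields x1 x2 z1 z2 z3)
        then have "x = x1 *\<^sub>R e + (0, x2, 0, 0, z3) + 0 + (0, 0, z1, z2, 0)" by (simp add: e_def)
        moreover have "(0, x2, 0, 0, z3) \<in> V1" "(0, 0, z1, z2, 0) \<in> V3" by (simp_all add: V1_def V3_def)
        ultimately show ?thesis by blast
      qed
    qed (auto simp: e_def V1_def V3_def subspace_def orthogonal_def zero_prod_def norm_Pair)
    have m0: "m 0 y = 0" "m x 0 = 0" "re 0 = 0" for x y
      using ml[of 0 0] mr[of _ 0 0] re[of 0 0] by simp_all
    show "cartan_poly m re (t *\<^sub>R e + \<xi> + \<zeta>) =
        t ^ 3 - 3 / 2 * t * (2 * (norm \<xi>)\<^sup>2 - (norm \<zeta>)\<^sup>2) + cartan_poly m re (\<xi> + \<zeta>)"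
      if "\<xi> \<in> V1" "\<zeta> \<in> V3" for t \<xi> \<zeta>
      using that by (auto simp: e_def V1_def V3_def norm_Pair algebra_simps)
    show "cartan_poly m re (r *\<^sub>R \<xi> + s *\<^sub>R \<zeta>) = r * s\<^sup>2 * cartan_poly m re (\<xi> + \<zeta>)"
      if "\<xi> \<in> V1" "\<zeta> \<in> V3" for r s \<xi> \<zeta>
      using that by (clarsimp simp: V1_def V3_def ml mr re power_mult_distrib) (simp add: algebra_simps power2_eq_square)
  qed
qed

text \<open>Here \<open>e\<close> is the direction of \<open>x2\<close>, \<open>V3\<close> is zero,
  and no \<psi> term remains.\<close>

lemma normal_form_theta0:
  fixes f :: "'a::euclidean_space \<Rightarrow> real"
  assumes cub: "cubic_form f" and cong: "congruent_forms f theta0"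
  shows "\<exists>e V1 V2 V3. normal_form f e V1 V2 V3 \<and> dim V2 = 0"
proof (rule normal_form_pullback[OF cub cong])
  let ?V1 = "{(x1, x2 :: real). x2 = 0} :: (real \<times> real) set"
  show "orthogonal_decomposition (0, 1) ?V1 {0} {0}"
    unfolding orthogonal_decomposition_def
  proof (intro conjI allI)
    show "\<exists>t. \<exists>\<xi>\<in>?V1. \<exists>\<eta>\<in>{0}. \<exists>\<zeta>\<in>{0}. x = t *\<^sub>R (0, 1) + \<xi> + \<eta> + \<zeta>" for x :: "real \<times> real"
    proof -
      have "x = snd x *\<^sub>R (0, 1) + (fst x, 0) + 0 + 0" by (simp add: prod_eq_iff)
      moreover have "(fst x, 0) \<in> ?V1" by simp
      ultimately show ?thesis by blast
    qed
  qed (auto simp: subspace_def orthogonal_def zero_prod_def norm_Pair)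
qed (auto simp: norm_Pair algebra_simps)

lemma quat_scaleR:
  "quat_mult (r *\<^sub>R x) y = r *\<^sub>R quat_mult x y" "quat_mult x (r *\<^sub>R y) = r *\<^sub>R quat_mult x y"
  "quat_Re (r *\<^sub>R x) = r * quat_Re x" "quat_cnj (r *\<^sub>R x) = r *\<^sub>R quat_cnj x"
proof -
  show "quat_mult (r *\<^sub>R x) y = r *\<^sub>R quat_mult x y"
    by (cases x; cases y) (simp add: quat_mult_def scaleR_diff_right scaleR_add_right)
  show "quat_mult x (r *\<^sub>R y) = r *\<^sub>R quat_mult x y"
    by (cases x; cases y) (simp add: quat_mult_def scaleR_diff_right scaleR_add_right)
  show "quat_Re (r *\<^sub>R x) = r * quat_Re x" by (simp add: quat_Re_def)
  show "quat_cnj (r *\<^sub>R x) = r *\<^sub>R quat_cnj x" by (cases x) (simp add: quat_cnj_def)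
qed

lemma octo_scaleR:
  "octo_mult (r *\<^sub>R x) y = r *\<^sub>R octo_mult x y" "octo_mult x (r *\<^sub>R y) = r *\<^sub>R octo_mult x y"
  "octo_Re (r *\<^sub>R x) = r * octo_Re x"
proof -
  obtain a b c d where xy: "x = (a, b)" "y = (c, d)" by (cases x; cases y) blast
  show "octo_mult (r *\<^sub>R x) y = r *\<^sub>R octo_mult x y" "octo_mult x (r *\<^sub>R y) = r *\<^sub>R octo_mult x y"
    by (simp_all only: xy octo_mult_def cd_mult.simps scaleR_Pair quat_scaleR scaleR_diff_right
        scaleR_add_right)
  show "octo_Re (r *\<^sub>R x) = r * octo_Re x" by (simp add: octo_Re_def quat_scaleR)
qed

theorem proposition3p4:
  fixes f :: "real ^ 'n \<Rightarrow> real"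
  assumes "radial_eigencubic f"
  shows "((\<exists>e V1 V2 V3. normal_form f e V1 V2 V3 \<and> dim V2 = 0) \<longleftrightarrow>
           congruent_forms f theta1 \<or> congruent_forms f theta2 \<or> congruent_forms f theta4 \<or>
           congruent_forms f theta8 \<or> congruent_forms f theta0)
       \<and> (\<forall>e V1 V2 V3. normal_form f e V1 V2 V3 \<and> dim V2 = 0 \<longrightarrow>
           (congruent_forms f theta0 \<longrightarrow> dim V1 = 0 + 1) \<and>
           (congruent_forms f theta1 \<longrightarrow> dim V1 = 1 + 1) \<and>
           (congruent_forms f theta2 \<longrightarrow> dim V1 = 2 + 1) \<and>
           (congruent_forms f theta4 \<longrightarrow> dim V1 = 4 + 1) \<and>
           (congruent_forms f theta8 \<longrightarrow> dim V1 = 8 + 1))"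
proof (intro conjI iffI allI impI)
  assume "\<exists>e V1 V2 V3. normal_form f e V1 V2 V3 \<and> dim V2 = 0"
  then show "congruent_forms f theta1 \<or> congruent_forms f theta2 \<or> congruent_forms f theta4 \<or>
      congruent_forms f theta8 \<or> congruent_forms f theta0"
    using normal_form_classification(1)[OF assms] by (elim exE conjE)
next
  have cub: "cubic_form f" using assms by (simp add: radial_eigencubic_def)
  assume "congruent_forms f theta1 \<or> congruent_forms f theta2 \<or> congruent_forms f theta4 \<or>
      congruent_forms f theta8 \<or> congruent_forms f theta0"
  then show "\<exists>e V1 V2 V3. normal_form f e V1 V2 V3 \<and> dim V2 = 0"
    unfolding theta1_def theta2_def theta4_def theta8_def
    by (elim disjE) (erule normal_form_cartan[OF cub] normal_form_theta0[OF cub];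
      simp add: quat_scaleR octo_scaleR)+
next
  fix e V1 V2 V3 assume nf: "normal_form f e V1 V2 V3 \<and> dim V2 = 0"
  \<comment> \<open>Hence \<open>dim V1\<close> can be read off from the ambient dimension, which is
    3 \<ell> + 2 for the Cartan polynomials and 2 for \<open>theta0\<close>.\<close>
  have dim: "CARD('n) + 1 = 3 * dim V1"
    using normal_form_classification(2,3)[OF assms, of e V1 V2 V3] nf by simp
  show "dim V1 = 0 + 1" if "congruent_forms f theta0"
    using congruent_forms_DIM[OF that] dim by simp
  show "dim V1 = 1 + 1" if "congruent_forms f theta1"
    using congruent_forms_DIM[OF that] dim by simp
  show "dim V1 = 2 + 1" if "congruent_forms f theta2"
    using congruent_forms_DIM[OF that] dim by simp
  show "dim V1 = 4 + 1" if "congruent_forms f theta4"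
    using congruent_forms_DIM[OF that] dim by simp
  show "dim V1 = 8 + 1" if "congruent_forms f theta8"
    using congruent_forms_DIM[OF that] dim by simp
qed

end
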